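(* Let $X$ be a standard Borel space, let $\Gamma$ be a Borel graph on $X$, and let $\rho$ be the graph metric on $\Gamma$. Assume that $\Gamma$ is locally finite and that $s=\mathrm{asi}(X,\rho)<\infty$. Then $\chi_{\mathbf{B}}(\Gamma)\le(s+1)\cdot(\chi(\Gamma)-1)+1$.
   Context: A Borel graph on $X$ is a graph with vertex set $X$ whose edge set $\Gamma$ is a Borel subset of $X\times X$. The graph metric $\rho(x,y)$ is the least length of a path joining $x$ and $y$, and $+\infty$ if no such path exists. $\Gamma$ is locally finite if every vertex has finite degree. A proper coloring is a function $c:X\to Z$ such that adjacent vertices get different values. The chromatic number $\chi(\Gamma)$ is the least cardinality of a set $Z$ for which a proper coloring $c:X\to Z$ exists; the Borel chromatic number $\chi_{\mathbf{B}}(\Gamma)$ is defined in the same way but requiring $Z$ to be a standard Borel space and $c$ to be Borel. If $\chi(\Gamma)$ is infinite, the right-hand side is read as $\chi(\Gamma)$. Asymptotic separation index: for $U\subseteq X$ and $r>0$ let $\mathfrak{F}_r(U)$ be the smallest equivalence relation on $U$ containing all pairs $(x,y)\in U\times U$ with $\rho(x,y)\le r$. Then $\mathrm{asi}(X,\rho)$ is the least $d\in\mathbb{N}$ such that for every $r>0$ there are Borel sets $U_0,\dots,U_d$ covering $X$ such that for every $i$ every class of $\mathfrak{F}_r(U_i)$ has finite $\rho$-diameter (no uniform bound required); it is $\infty$ if no such $d$ exists. *)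

theory Defs
  imports "HOL-Analysis.Analysis"
begin

unbundle cardinal_syntax

section \<open>Standard Borel spaces and Borel graphs\<close>

text \<open>Measurable spaces are given as \<open>'a measure\<close>; only \<open>space\<close> and \<open>sets\<close> matter, the measure
  itself plays no role.\<close>

definition Polish_space :: "'a topology \<Rightarrow> bool" where
  "Polish_space T \<longleftrightarrow> separable_space T \<and> completely_metrizable_space T"

definition standard_Borel :: "'a measure \<Rightarrow> bool" where
  "standard_Borel M \<longleftrightarrow>
     (\<exists>T. Polish_space T \<and> topspace T = space M \<and>
          sets M = sigma_sets (space M) {U. openin T U})"

definition Borel_graph :: "'a measure \<Rightarrow> ('a \<times> 'a) set \<Rightarrow> bool" where
  "Borel_graph M \<Gamma> \<longleftrightarrow> \<Gamma> \<in> sets (M \<Otimes>\<^sub>M M) \<and> sym \<Gamma> \<and> irrefl \<Gamma>"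

definition locally_finite_graph :: "'a set \<Rightarrow> ('a \<times> 'a) set \<Rightarrow> bool" where
  "locally_finite_graph X \<Gamma> \<longleftrightarrow> (\<forall>x\<in>X. finite {y. (x, y) \<in> \<Gamma>})"

section \<open>The graph metric\<close>

text \<open>A path is represented by the list of its vertices.\<close>

definition graph_path :: "('a \<times> 'a) set \<Rightarrow> 'a \<Rightarrow> 'a list \<Rightarrow> 'a \<Rightarrow> bool" where
  "graph_path \<Gamma> x p y \<longleftrightarrow>
     p \<noteq> [] \<and> hd p = x \<and> last p = y \<and> distinct p \<and> successively (\<lambda>u v. (u, v) \<in> \<Gamma>) p"

text \<open>The infimum of the empty set is \<open>\<infinity>\<close>.\<close>

definition graph_metric :: "('a \<times> 'a) set \<Rightarrow> 'a \<Rightarrow> 'a \<Rightarrow> ennreal" where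
  "graph_metric \<Gamma> x y = (INF p \<in> {p. graph_path \<Gamma> x p y}. of_nat (length p - 1))"

section \<open>Asymptotic separation index\<close>

definition scale_rel :: "('a \<Rightarrow> 'a \<Rightarrow> ennreal) \<Rightarrow> real \<Rightarrow> 'a set \<Rightarrow> ('a \<times> 'a) set" where
  "scale_rel \<rho> r U =
     \<Inter>{E. equiv U E \<and> (\<forall>x\<in>U. \<forall>y\<in>U. \<rho> x y \<le> ennreal r \<longrightarrow> (x, y) \<in> E)}"

definition ext_diameter :: "('a \<Rightarrow> 'a \<Rightarrow> ennreal) \<Rightarrow> 'a set \<Rightarrow> ennreal" where
  "ext_diameter \<rho> C = (SUP x\<in>C. SUP y\<in>C. \<rho> x y)"

definition asi_le :: "'a measure \<Rightarrow> ('a \<Rightarrow> 'a \<Rightarrow> ennreal) \<Rightarrow> nat \<Rightarrow> bool" where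
  "asi_le M \<rho> d \<longleftrightarrow>
     (\<forall>r>0. \<exists>U :: nat \<Rightarrow> 'a set.
        (\<forall>i\<le>d. U i \<in> sets M) \<and> (\<Union>i\<le>d. U i) = space M \<and>
        (\<forall>i\<le>d. \<forall>C \<in> U i // scale_rel \<rho> r (U i). ext_diameter \<rho> C < \<infinity>))"

definition asi :: "'a measure \<Rightarrow> ('a \<Rightarrow> 'a \<Rightarrow> ennreal) \<Rightarrow> enat" where
  "asi M \<rho> = (INF d \<in> {d. asi_le M \<rho> d}. enat d)"

section \<open>Chromatic numbers\<close>

definition proper_coloring :: "'a set \<Rightarrow> ('a \<times> 'a) set \<Rightarrow> 'z set \<Rightarrow> ('a \<Rightarrow> 'z) \<Rightarrow> bool" where
  "proper_coloring X \<Gamma> Z c \<longleftrightarrow>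
     c \<in> X \<rightarrow> Z \<and> (\<forall>x\<in>X. \<forall>y\<in>X. (x, y) \<in> \<Gamma> \<longrightarrow> c x \<noteq> c y)"

text \<open>Cardinals are cardinal orders compared by \<open>\<le>o\<close>, since \<open>enat\<close> would identify all
  infinite cardinals.\<close>

definition least_card :: "('b set \<Rightarrow> bool) \<Rightarrow> 'b rel" where
  "least_card P = |SOME Z. P Z \<and> (\<forall>Z'. P Z' \<longrightarrow> |Z| \<le>o |Z'| )|"

text \<open>In both definitions the color sets range over subsets of the vertex type only. This loses no
  generality: the identity is a (Borel) proper coloring of a loopless (Borel) graph, so only color
  sets of cardinality at most that of the vertex set are relevant; see the lemmas
  \<open>chromatic_number_le\<close> and \<open>Borel_chromatic_number_le\<close>, where the type of colors is arbitrary.\<close>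

definition chromatic_number :: "'a set \<Rightarrow> ('a \<times> 'a) set \<Rightarrow> 'a rel" where
  "chromatic_number X \<Gamma> = least_card (\<lambda>Z :: 'a set. \<exists>c. proper_coloring X \<Gamma> Z c)"

definition Borel_chromatic_number :: "'a measure \<Rightarrow> ('a \<times> 'a) set \<Rightarrow> 'a rel" where
  "Borel_chromatic_number M \<Gamma> =
     least_card (\<lambda>Z :: 'a set. \<exists>N c. standard_Borel N \<and> space N = Z \<and>
       c \<in> M \<rightarrow>\<^sub>M N \<and> proper_coloring (space M) \<Gamma> Z c)"

lemma least_card_works:
  fixes P :: "'b set \<Rightarrow> bool"
  assumes "P Z0"
  shows "\<exists>Z. P Z \<and> least_card P = |Z|" and "\<And>Z. P Z \<Longrightarrow> least_card P \<le>o |Z|"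
proof -
  let ?Q = "\<lambda>Z. P Z \<and> (\<forall>Z'. P Z' \<longrightarrow> |Z| \<le>o |Z'| )"
  have "\<exists>r \<in> card_of ` {Z. P Z}. \<forall>r' \<in> card_of ` {Z. P Z}. r \<le>o r'"
    by (rule exists_minim_Card_order) (use assms card_of_Card_order in auto)
  then have "\<exists>Z. ?Q Z" by auto
  then have "?Q (SOME Z. ?Q Z)" by (rule someI_ex)
  then show "\<exists>Z. P Z \<and> least_card P = |Z|" and "\<And>Z. P Z \<Longrightarrow> least_card P \<le>o |Z|"
    unfolding least_card_def by blast+
qed

lemma chromatic_number_le:
  fixes Z :: "'z set"
  assumes c: "proper_coloring X \<Gamma> Z c"
  shows "chromatic_number X \<Gamma> \<le>o |Z|"
proof -
  let ?g = "inv_into X c"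
  have "proper_coloring X \<Gamma> (?g ` (c ` X)) (?g \<circ> c)"
    using c unfolding proper_coloring_def by (auto dest!: inv_into_injective)
  then have "chromatic_number X \<Gamma> \<le>o |?g ` (c ` X)|"
    unfolding chromatic_number_def by (intro least_card_works(2)) blast+
  also have "|?g ` (c ` X)| \<le>o |c ` X|" by (rule card_of_image)
  also have "|c ` X| \<le>o |Z|"
    using c by (intro card_of_mono1) (auto simp: proper_coloring_def)
  finally show ?thesis .
qed

lemma standard_Borel_transport:
  fixes N :: "'z measure" and f :: "'z \<Rightarrow> 'a"
  assumes N: "standard_Borel N" and f: "inj_on f (space N)"
  obtains L :: "'a measure" where "standard_Borel L" "space L = f ` space N" "f \<in> N \<rightarrow>\<^sub>M L"
proof -
  obtain T where T: "Polish_space T" "topspace T = space N"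
      "sets N = sigma_sets (space N) {U. openin T U}"
    using N unfolding standard_Borel_def by blast
  let ?g = "inv_into (space N) f"
  define T' where "T' = pullback_topology (f ` space N) ?g T"
  have ts: "topspace T' = f ` space N"
    using T(2) f by (auto simp: T'_def topspace_pullback_topology)
  have op: "openin T' V \<longleftrightarrow> (\<exists>U. openin T U \<and> V = ?g -` U \<inter> f ` space N)" for V
    by (auto simp: T'_def openin_pullback_topology)
  have vim: "f -` (?g -` U \<inter> f ` space N) \<inter> space N = U" if "openin T U" for U
    using openin_subset[OF that] T(2) f by (auto dest: inj_onD)
  have "homeomorphic_maps T T' f ?g"
    unfolding homeomorphic_maps_def
  proof (intro conjI ballI)
    show "continuous_map T T' f"
      unfolding continuous_map_alt
    proof (intro conjI allI impI)
      fix V assume "openin T' V"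
      then show "openin T (f -` V \<inter> topspace T)"
        using vim T(2) by (auto simp: op)
    qed (use ts T(2) in auto)
    show "continuous_map T' T ?g"
      unfolding continuous_map_alt
    proof (intro conjI allI impI)
      fix U assume "openin T U"
      then show "openin T' (?g -` U \<inter> topspace T')"
        unfolding op ts by blast
    qed (use ts T(2) f in \<open>auto simp: inv_into_into\<close>)
  qed (use ts T(2) f in auto)
  then have "T homeomorphic_space T'"
    unfolding homeomorphic_space_def by blast
  then have P: "Polish_space T'"
    using T(1) homeomorphic_separable_space homeomorphic_completely_metrizable_space
    unfolding Polish_space_def by blast
  define L where "L = sigma (f ` space N) {V. openin T' V}"
  have sub: "{V. openin T' V} \<subseteq> Pow (f ` space N)"
    using openin_subset ts by fastforce
  have L: "space L = f ` space N" "sets L = sigma_sets (f ` space N) {V. openin T' V}"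
    using sub by (simp_all add: L_def)
  show ?thesis
  proof
    show "standard_Borel L"
      unfolding standard_Borel_def using P ts L by auto
    show "f \<in> N \<rightarrow>\<^sub>M L"
      unfolding L_def
    proof (rule measurable_measure_of[OF sub])
      fix V assume "V \<in> {V. openin T' V}"
      then show "f -` V \<inter> space N \<in> sets N"
        using vim unfolding T(3) by (auto simp: op)
    qed auto
  qed (rule L)
qed

lemma Borel_chromatic_number_le:
  fixes M :: "'a measure" and N :: "'z measure"
  assumes M: "standard_Borel M" "irrefl \<Gamma>"
    and N: "standard_Borel N" "c \<in> M \<rightarrow>\<^sub>M N" "proper_coloring (space M) \<Gamma> (space N) c"
  shows "Borel_chromatic_number M \<Gamma> \<le>o |space N|"
proof -
  let ?P = "\<lambda>Z :: 'a set. \<exists>N c. standard_Borel N \<and> space N = Z \<and>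
       c \<in> M \<rightarrow>\<^sub>M N \<and> proper_coloring (space M) \<Gamma> Z c"
  consider "|space M| \<le>o |space N|" | "|space N| \<le>o |space M|"
    using ordLeq_total[OF card_of_Well_order card_of_Well_order] by metis
  then show ?thesis
  proof cases
    case 1
    have "proper_coloring (space M) \<Gamma> (space M) id"
      using M(2) by (auto simp: proper_coloring_def irrefl_def)
    then have P: "?P (space M)"
      using M(1) measurable_ident[of M] by blast
    have "Borel_chromatic_number M \<Gamma> \<le>o |space M|"
      unfolding Borel_chromatic_number_def by (rule least_card_works(2)[where P = ?P, OF P P])
    then show ?thesis using 1 by (rule ordLeq_transitive)
  next
    case 2
    then obtain f :: "'z \<Rightarrow> 'a" where f: "inj_on f (space N)"
      using card_of_ordLeq[of "space N" "space M"] by metis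
    obtain L :: "'a measure" where L: "standard_Borel L" "space L = f ` space N" "f \<in> N \<rightarrow>\<^sub>M L"
      using standard_Borel_transport[OF N(1) f] .
    have "f (c x) \<noteq> f (c y)" if "x \<in> space M" "y \<in> space M" "(x, y) \<in> \<Gamma>" for x y
      using N(3) f that unfolding proper_coloring_def by (metis Pi_mem inj_onD)
    then have "proper_coloring (space M) \<Gamma> (f ` space N) (f \<circ> c)"
      using N(3) by (auto simp: proper_coloring_def)
    then have P: "?P (f ` space N)"
      using L(1,2) measurable_comp[OF N(2) L(3)] by blast
    have "Borel_chromatic_number M \<Gamma> \<le>o |f ` space N|"
      unfolding Borel_chromatic_number_def by (rule least_card_works(2)[where P = ?P, OF P P])
    then show ?thesis using card_of_image by (rule ordLeq_transitive)
  qed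
qed

end

(* A Borel set P in X x X with finite sections is, by Novikov's separation theorem for countably many
   analytic sets, a countable union of graphs of Borel partial functions.  The domain of such a
   function g is Borel, because separating disjoint analytic sets extends the codes of g(x) to Borel
   functions on X.  Hence projections of P, and neighbourhoods of Borel sets in a locally finite
   Borel graph, are Borel.

   For r = 3 take U_0, ..., U_s as in the definition of asi and let V_i be U_i together with its
   neighbours.  The components of the graph on V_i are finite, so V_i has a Borel coloring f_i with
   k = chi colors 0, ..., k-1: countably many Borel functions extend every finite coloring, and each
   component uses the first one that is proper on it.  Give x the color (i, j), j > 0, for the least i
   with x in V_i and j = f_i(x) > 0; all other points get one extra color.  Two adjacent points cannot
   both be left over, since they lie in a common V_i, where f_i separates them.  This uses
   (s+1)(k-1)+1 colors.  For infinite chi it suffices that a locally finite Borel graph has a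
   countable Borel coloring. *)

theory Submission
  imports Defs
begin

section \<open>Analytic sets\<close>

text \<open>Closed subsets of Baire space serve as domains, instead of the whole space, so that the
  empty set is included and any further closed condition on codes can be imposed by shrinking the
  domain. Nonempty closed sets are retracts of Baire space, so this is the usual notion.\<close>

definition analytic_in :: "'a topology \<Rightarrow> 'a set \<Rightarrow> bool" where
  "analytic_in T A \<longleftrightarrow>
     (\<exists>(F :: (nat \<Rightarrow> nat) set) g. closed F \<and> continuous_map (top_of_set F) T g \<and> g ` F = A)"

lemma analytic_inE:
  assumes "analytic_in T A"
  obtains F :: "(nat \<Rightarrow> nat) set" and g
  where "closed F" "continuous_map (top_of_set F) T g" "g ` F = A"
  using assms unfolding analytic_in_def by blast

section \<open>Closure properties of analytic sets\<close>

lemma analytic_in_subset: "analytic_in T A \<Longrightarrow> A \<subseteq> topspace T"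
  unfolding analytic_in_def by (auto dest!: continuous_map_image_subset_topspace)

lemma analytic_in_empty [simp]: "analytic_in T {}"
  unfolding analytic_in_def by (intro exI[of _ "{}"]) (auto simp: continuous_map_def)

lemma analytic_in_image:
  assumes "analytic_in T A" "continuous_map T T' f"
  shows "analytic_in T' (f ` A)"
proof -
  obtain F :: "(nat \<Rightarrow> nat) set" and g where F: "closed F" "continuous_map (top_of_set F) T g" "g ` F = A"
    using assms(1) by (rule analytic_inE)
  show ?thesis
    unfolding analytic_in_def
    using F continuous_map_compose[OF F(2) assms(2)] by (intro exI[of _ F] exI[of _ "f \<circ> g"]) auto
qed

lemma analytic_in_Int_closedin:
  assumes "analytic_in T A" "closedin T C"
  shows "analytic_in T (A \<inter> C)"
proof -
  obtain F :: "(nat \<Rightarrow> nat) set" and g where F: "closed F" "continuous_map (top_of_set F) T g" "g ` F = A"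
    using assms(1) by (rule analytic_inE)
  define F' where "F' = {x \<in> F. g x \<in> C}"
  have "closedin (top_of_set F) F'"
    using closedin_continuous_map_preimage[OF F(2) assms(2)] by (simp add: F'_def)
  then have "closed F'"
    using F(1) closedin_closed_trans by blast
  moreover have "continuous_map (top_of_set F') T g"
    using continuous_map_from_subtopology_mono[OF F(2)] by (simp add: F'_def)
  moreover have "g ` F' = A \<inter> C"
    using F(3) by (auto simp: F'_def)
  ultimately show ?thesis
    unfolding analytic_in_def by blast
qed

lemma open_coordinate_eq: "open {f :: nat \<Rightarrow> nat. f i = n}"
proof -
  have "open ((\<lambda>f :: nat \<Rightarrow> nat. f i) -` {n})"
    by (intro open_vimage continuous_on_product_coordinates open_discrete)
  then show ?thesis by (simp add: vimage_def)
qed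

lemma continuous_on_reindex: "continuous_on UNIV (\<lambda>f :: nat \<Rightarrow> nat. \<lambda>n. f (h n))"
  by (intro continuous_on_coordinatewise_then_product continuous_on_product_coordinates)

text \<open>Coordinate 0 of a code selects the index \<open>n\<close>, and the shifted sequence is a
  code for a point of \<open>A n\<close>. Fixing a coordinate is a clopen condition, so the maps
  \<open>g n\<close> paste together continuously.\<close>

lemma analytic_in_UN:
  fixes A :: "nat \<Rightarrow> 'a set"
  assumes "\<And>n. analytic_in T (A n)"
  shows "analytic_in T (\<Union>n. A n)"
proof -
  have "\<exists>(F :: (nat \<Rightarrow> nat) set) g. closed F \<and> continuous_map (top_of_set F) T g \<and> g ` F = A n" for n
    using assms unfolding analytic_in_def by blast
  then obtain F :: "nat \<Rightarrow> (nat \<Rightarrow> nat) set" and g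
    where F: "\<And>n. closed (F n)" "\<And>n. continuous_map (top_of_set (F n)) T (g n)" "\<And>n. g n ` F n = A n"
    by metis
  let ?sh = "\<lambda>f :: nat \<Rightarrow> nat. \<lambda>n. f (Suc n)"
  define F' where "F' = {f. ?sh f \<in> F (f 0)}"
  define g' where "g' f = g (f 0) (?sh f)" for f
  have "- F' = (\<Union>n. {f. f 0 = n} \<inter> ?sh -` (- F n))"
    by (auto simp: F'_def)
  also have "open \<dots>"
    using F(1) by (intro open_UN ballI open_Int open_coordinate_eq open_vimage continuous_on_reindex) auto
  finally have "closed F'" by (simp add: closed_def)
  moreover have "continuous_map (top_of_set F') T g'"
  proof (rule pasting_lemma[where I = UNIV and T = "\<lambda>n. F' \<inter> {f. f 0 = n}"
        and f = "\<lambda>n f. g n (?sh f)"])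
    fix n :: nat
    show "openin (top_of_set F') (F' \<inter> {f. f 0 = n})"
      using open_coordinate_eq by (simp add: openin_open_Int)
    have "continuous_map (top_of_set (F' \<inter> {f. f 0 = n})) (top_of_set (F n)) ?sh"
      by (auto simp: continuous_map_in_subtopology F'_def
               intro: continuous_on_subset[OF continuous_on_reindex])
    from continuous_map_compose[OF this F(2)]
    have "continuous_map (top_of_set (F' \<inter> {f. f 0 = n})) T (\<lambda>f. g n (?sh f))"
      by (simp add: o_def)
    then show "continuous_map (subtopology (top_of_set F') (F' \<inter> {f. f 0 = n})) T (\<lambda>f. g n (?sh f))"
      by (simp add: subtopology_subtopology Int_absorb1)
  qed (auto simp: g'_def)
  moreover have "g' ` F' = (\<Union>n. A n)"
  proof (intro equalityI subsetI)
    fix y assume "y \<in> g' ` F'"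
    then show "y \<in> (\<Union>n. A n)" using F(3) by (auto simp: F'_def g'_def)
  next
    fix y assume "y \<in> (\<Union>n. A n)"
    then obtain n h where h: "h \<in> F n" "y = g n h" using F(3) by blast
    let ?f = "\<lambda>m. case m of 0 \<Rightarrow> n | Suc m \<Rightarrow> h m"
    have "?f \<in> F'" "g' ?f = y" using h by (auto simp: F'_def g'_def)
    then show "y \<in> g' ` F'" by blast
  qed
  ultimately show ?thesis
    unfolding analytic_in_def by blast
qed

text \<open>One sequence is read as an infinite matrix through \<open>prod_encode\<close>, row
  \<open>n\<close> being a code for a point of \<open>A n\<close>. The Hausdorff property makes it a
  closed condition that all rows code the same point.\<close>

lemma analytic_in_INT:
  fixes A :: "nat \<Rightarrow> 'a set"
  assumes T: "Hausdorff_space T" and A: "\<And>n. analytic_in T (A n)"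
  shows "analytic_in T (\<Inter>n. A n)"
proof -
  have "\<exists>(F :: (nat \<Rightarrow> nat) set) g. closed F \<and> continuous_map (top_of_set F) T g \<and> g ` F = A n" for n
    using A unfolding analytic_in_def by blast
  then obtain F :: "nat \<Rightarrow> (nat \<Rightarrow> nat) set" and g
    where F: "\<And>n. closed (F n)" "\<And>n. continuous_map (top_of_set (F n)) T (g n)" "\<And>n. g n ` F n = A n"
    by metis
  define row where "row n = (\<lambda>f :: nat \<Rightarrow> nat. \<lambda>k. f (prod_encode (n, k)))" for n
  define R where "R = (\<Inter>n. row n -` F n)"
  have cR: "closed R"
    using F(1) unfolding R_def row_def
    by (intro closed_INT ballI closed_vimage continuous_on_reindex) auto
  have row: "continuous_map (top_of_set R) T (\<lambda>f. g n (row n f))" for n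
  proof -
    have "continuous_map (top_of_set R) (top_of_set (F n)) (row n)"
      unfolding row_def
      by (auto simp: continuous_map_in_subtopology R_def row_def
               intro: continuous_on_subset[OF continuous_on_reindex])
    from continuous_map_compose[OF this F(2)] show ?thesis by (simp add: o_def)
  qed
  define F' where "F' = (\<Inter>n. {f \<in> R. g n (row n f) = g 0 (row 0 f)})"
  have "closedin (top_of_set R) {f \<in> R. g n (row n f) = g 0 (row 0 f)}" for n
    using closedin_continuous_maps_eq[OF T row[of n] row[of 0]] by simp
  then have "closed F'"
    unfolding F'_def using cR closedin_closed_trans by (intro closed_INT) blast
  moreover have "continuous_map (top_of_set F') T (\<lambda>f. g 0 (row 0 f))"
    by (rule continuous_map_from_subtopology_mono[OF row]) (auto simp: F'_def)
  moreover have "(\<lambda>f. g 0 (row 0 f)) ` F' = (\<Inter>n. A n)"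
  proof (intro equalityI subsetI)
    fix y assume "y \<in> (\<lambda>f. g 0 (row 0 f)) ` F'"
    then obtain f where "f \<in> F'" "y = g 0 (row 0 f)" by blast
    then have "row n f \<in> F n \<and> g n (row n f) = y" for n
      by (simp add: F'_def R_def)
    then have "y \<in> A n" for n using F(3)[of n] by (metis imageI)
    then show "y \<in> (\<Inter>n. A n)" by simp
  next
    fix y assume y: "y \<in> (\<Inter>n. A n)"
    then have "\<exists>h. h \<in> F n \<and> g n h = y" for n using F(3)[of n] by blast
    then obtain h where h: "\<And>n. h n \<in> F n" "\<And>n. g n (h n) = y" by metis
    let ?f = "\<lambda>m. case prod_decode m of (n, k) \<Rightarrow> h n k"
    have row_f: "row n ?f = h n" for n by (auto simp: row_def)
    have "?f \<in> F'" using h unfolding F'_def R_def by (auto simp: row_f)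
    moreover have "y = g 0 (row 0 ?f)" using h by (simp add: row_f)
    ultimately show "y \<in> (\<lambda>f. g 0 (row 0 f)) ` F'" by (simp only: image_iff) blast
  qed
  ultimately show ?thesis
    unfolding analytic_in_def by blast
qed

lemma analytic_in_Un:
  assumes "analytic_in T A" "analytic_in T B"
  shows "analytic_in T (A \<union> B)"
proof -
  have "analytic_in T (\<Union>n::nat. if n = 0 then A else B)"
    by (rule analytic_in_UN) (use assms in auto)
  moreover have "(\<Union>n::nat. if n = 0 then A else B) = A \<union> B"
    by (auto split: if_splits)
  ultimately show ?thesis by simp
qed

lemma analytic_in_Int:
  assumes "Hausdorff_space T" "analytic_in T A" "analytic_in T B"
  shows "analytic_in T (A \<inter> B)"
proof -
  have "analytic_in T (\<Inter>n::nat. if n = 0 then A else B)"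
    by (rule analytic_in_INT) (use assms in auto)
  moreover have "(\<Inter>n::nat. if n = 0 then A else B) = A \<inter> B"
    by (auto split: if_splits)
  ultimately show ?thesis by simp
qed

lemma analytic_in_Times:
  assumes "analytic_in T A" "analytic_in T' B"
  shows "analytic_in (prod_topology T T') (A \<times> B)"
proof -
  obtain F :: "(nat \<Rightarrow> nat) set" and g where F: "closed F" "continuous_map (top_of_set F) T g" "g ` F = A"
    using assms(1) by (rule analytic_inE)
  obtain F' :: "(nat \<Rightarrow> nat) set" and g' where F': "closed F'" "continuous_map (top_of_set F') T' g'" "g' ` F' = B"
    using assms(2) by (rule analytic_inE)
  define ev where "ev = (\<lambda>f :: nat \<Rightarrow> nat. \<lambda>n. f (2 * n))"
  define od where "od = (\<lambda>f :: nat \<Rightarrow> nat. \<lambda>n. f (Suc (2 * n)))"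
  define R where "R = ev -` F \<inter> od -` F'"
  have c: "continuous_on S ev" "continuous_on S od" for S
    unfolding ev_def od_def by (rule continuous_on_subset[OF continuous_on_reindex], simp)+
  have "closed R"
    unfolding R_def by (intro closed_Int closed_vimage F(1) F'(1) c)
  moreover have "continuous_map (top_of_set R) (prod_topology T T') (\<lambda>f. (g (ev f), g' (od f)))"
  proof (rule continuous_map_pairedI)
    have "continuous_map (top_of_set R) (top_of_set F) ev"
      using c by (auto simp: continuous_map_in_subtopology R_def)
    from continuous_map_compose[OF this F(2)]
    show "continuous_map (top_of_set R) T (\<lambda>f. g (ev f))" by (simp add: o_def)
    have "continuous_map (top_of_set R) (top_of_set F') od"
      using c by (auto simp: continuous_map_in_subtopology R_def)
    from continuous_map_compose[OF this F'(2)]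
    show "continuous_map (top_of_set R) T' (\<lambda>f. g' (od f))" by (simp add: o_def)
  qed
  moreover have "(\<lambda>f. (g (ev f), g' (od f))) ` R = A \<times> B"
  proof (intro equalityI subsetI)
    fix p assume "p \<in> A \<times> B"
    then obtain u v where uv: "u \<in> F" "v \<in> F'" "p = (g u, g' v)" using F(3) F'(3) by auto
    let ?f = "\<lambda>n. if even n then u (n div 2) else v (n div 2)"
    have f: "ev ?f = u" "od ?f = v" by (auto simp: ev_def od_def)
    then show "p \<in> (\<lambda>f. (g (ev f), g' (od f))) ` R"
      using uv by (intro image_eqI[of _ _ ?f]) (auto simp: R_def)
  qed (use F(3) F'(3) in \<open>auto simp: R_def\<close>)
  ultimately show ?thesis
    unfolding analytic_in_def by blast
qed

text \<open>Closed sets are analytic as intersections with the analytic carrier, and in a metrizable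
  space every open set is a countable union of closed sets.\<close>

lemma analytic_in_openin:
  assumes "metrizable_space T" "analytic_in T (topspace T)" "openin T U"
  shows "analytic_in T U"
proof -
  have "fsigma_in T U"
    using assms by (simp add: open_imp_fsigma_in)
  then obtain \<C> where \<C>: "countable \<C>" "\<C> \<subseteq> Collect (closedin T)" "\<Union>\<C> = U"
    unfolding fsigma_in_def union_of_def by auto
  have an: "analytic_in T C" if "closedin T C" for C
    using analytic_in_Int_closedin[OF assms(2) that] closedin_subset[OF that] by (simp add: Int_absorb1)
  show ?thesis
  proof (cases "\<C> = {}")
    case False
    then have "U = (\<Union>n. from_nat_into \<C> n)"
      using \<C> range_from_nat_into[OF False \<C>(1)] by simp
    moreover have "analytic_in T (from_nat_into \<C> n)" for n
      using an \<C>(2) from_nat_into[OF False] by blast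
    ultimately show ?thesis using analytic_in_UN by metis
  qed (use \<C> in auto)
qed

text \<open>Analytic sets are not closed under complements, so the induction carries a set and its
  complement together; complementation then merely swaps the two, and unions become
  intersections.\<close>

lemma analytic_in_sigma_sets:
  assumes T: "Hausdorff_space T"
    and S: "\<And>A. A \<in> S \<Longrightarrow> analytic_in T A" "\<And>A. A \<in> S \<Longrightarrow> analytic_in T (topspace T - A)"
    and B: "B \<in> sigma_sets (topspace T) S"
    and X: "analytic_in T (topspace T)"
  shows "analytic_in T B"
proof -
  have "analytic_in T B \<and> analytic_in T (topspace T - B)"
    using B
  proof induction
    case (Compl A)
    then show ?case by (metis Diff_Diff_Int analytic_in_subset inf.absorb2)
  next
    case (Union A)
    have "topspace T - (\<Union>i. A i) = (\<Inter>i. topspace T - A i)" by auto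
    then show ?case using Union analytic_in_UN analytic_in_INT[OF T] by metis
  qed (use S X in auto)
  then show ?thesis ..
qed

text \<open>If no separation exists, then successively fixing the coordinates of points of the closed sets
  representing the \<open>A n\<close> keeps the family inseparable; in the limit the images of these points
  coincide.\<close>

lemma Novikov_separation:
  fixes N :: "'a measure" and A :: "nat \<Rightarrow> 'a set"
  assumes sp: "topspace T = space N"
    and haus: "\<And>x y. x \<in> space N \<Longrightarrow> y \<in> space N \<Longrightarrow> x \<noteq> y \<Longrightarrow>
      \<exists>U V. openin T U \<and> openin T V \<and> U \<in> sets N \<and> V \<in> sets N \<and> x \<in> U \<and> y \<in> V \<and> U \<inter> V = {}"
    and A: "\<And>n. analytic_in T (A n)" and disj: "(\<Inter>n. A n) = {}"
  obtains B where "\<And>n. B n \<in> sets N" "\<And>n. A n \<subseteq> B n" "(\<Inter>n. B n) = {}"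
proof -
  define sep where
    "sep A \<longleftrightarrow> (\<exists>B. (\<forall>n::nat. B n \<in> sets N \<and> A n \<subseteq> B n) \<and> (\<Inter>n. B n) = {})" for A :: "nat \<Rightarrow> 'a set"
  have "\<exists>(F :: (nat \<Rightarrow> nat) set) g. closed F \<and> continuous_map (top_of_set F) T g \<and> g ` F = A n" for n
    using A unfolding analytic_in_def by blast
  then obtain F :: "nat \<Rightarrow> (nat \<Rightarrow> nat) set" and g
    where F: "\<And>n. closed (F n)" "\<And>n. continuous_map (top_of_set (F n)) T (g n)" "\<And>n. g n ` F n = A n"
    by metis
  have gsp: "g n h \<in> space N" if "h \<in> F n" for n h
    using F(2)[of n] that sp by (auto simp: continuous_map_def)
  \<comment> \<open>The single sequence \<open>f\<close> prescribes the coordinates of codes for all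
    the sets at once: its entry at \<open>prod_encode (n, k)\<close> prescribes coordinate
    \<open>k\<close> of the code for \<open>A n\<close>. At stage \<open>t\<close> only the first
    \<open>t\<close> prescriptions are in force.\<close>
  define H where "H f t n = {h \<in> F n. \<forall>k. prod_encode (n, k) < t \<longrightarrow> h k = f (prod_encode (n, k))}"
    for f :: "nat \<Rightarrow> nat" and t n
  have step: "\<exists>j. \<not> sep (\<lambda>n. g n ` H (f(t := j)) (Suc t) n)" if "\<not> sep (\<lambda>n. g n ` H f t n)" for f t
  proof (rule ccontr)
    obtain m k where mk: "t = prod_encode (m, k)"
      by (metis prod_decode_inverse surj_pair)
    assume "\<not> ?thesis"
    then have "\<exists>B. (\<forall>n. B n \<in> sets N \<and> g n ` H (f(t := j)) (Suc t) n \<subseteq> B n) \<and> (\<Inter>n. B n) = {}" for j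
      by (auto simp: sep_def)
    then obtain B where B: "\<And>j n. B j n \<in> sets N" "\<And>j n. g n ` H (f(t := j)) (Suc t) n \<subseteq> B j n"
        "\<And>j. (\<Inter>n. B j n) = {}"
      by metis
    \<comment> \<open>Stage \<open>t\<close> constrains only the family of index \<open>m\<close>,
      whose image is the union over all values \<open>j\<close> of the new coordinate. Hence the
      separators are united at \<open>m\<close> and intersected elsewhere; a common point would lie
      in some \<open>B j m\<close> and then in every \<open>B j n\<close> with the same
      \<open>j\<close>.\<close>
    define B' where "B' n = (if n = m then \<Union>j. B j n else \<Inter>j. B j n)" for n
    have "B' n \<in> sets N" for n
      using B(1) by (auto simp: B'_def)
    moreover have "g n ` H f t n \<subseteq> B' n" for n
    proof (cases "n = m")
      case True
      have "h \<in> H (f(t := h k)) (Suc t) n" if "h \<in> H f t n" for h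
        using that True mk by (auto simp: H_def less_Suc_eq)
      then show ?thesis using B(2) True by (fastforce simp: B'_def)
    next
      case False
      have "h \<in> H (f(t := j)) (Suc t) n" if "h \<in> H f t n" for h j
        using that False mk by (auto simp: H_def less_Suc_eq)
      then show ?thesis using B(2) False by (fastforce simp: B'_def)
    qed
    moreover have "(\<Inter>n. B' n) = {}"
    proof (rule ccontr)
      assume "(\<Inter>n. B' n) \<noteq> {}"
      then obtain x where x: "\<And>n. x \<in> B' n" by blast
      then obtain j where "x \<in> B j m" using x[of m] by (auto simp: B'_def)
      then have "x \<in> B j n" for n using x[of n] by (cases "n = m") (auto simp: B'_def)
      then show False using B(3)[of j] by blast
    qed
    ultimately have "sep (\<lambda>n. g n ` H f t n)"
      unfolding sep_def by (intro exI[of _ B'] conjI allI)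
    with that show False ..
  qed
  have "sep A"
  proof (rule ccontr)
    assume "\<not> sep A"
    then have init: "\<not> sep (\<lambda>n. g n ` H (\<lambda>_. 0) 0 n)" using F(3) by (simp add: H_def)
    obtain f where f: "\<And>t. \<not> sep (\<lambda>n. g n ` H (f t) t n)" "\<And>t. \<exists>j. f (Suc t) = (f t)(t := j)"
    proof (rule dependent_nat_choice[of "\<lambda>t f. \<not> sep (\<lambda>n. g n ` H f t n)" "\<lambda>t f f'. \<exists>j. f' = f(t := j)", THEN exE])
      show "\<exists>f. \<not> sep (\<lambda>n. g n ` H f 0 n)" using init by blast
      show "\<exists>f'. \<not> sep (\<lambda>n. g n ` H f' (Suc t) n) \<and> (\<exists>j. f' = f(t := j))"
        if "\<not> sep (\<lambda>n. g n ` H f t n)" for f t using step[OF that] by blast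
    qed blast
    \<comment> \<open>Stage \<open>t\<close> settles entry \<open>t\<close> and no later stage
      changes it, so the approximations \<open>f t\<close> have a limit, and \<open>H\<close> at
      stage \<open>t\<close> cannot distinguish the two.\<close>
    define c where "c t = f (Suc t) t" for t
    have fc: "f t i = c i" if "i < t" for i t
      using that
    proof (induction t)
      case (Suc t)
      then show ?case using f(2)[of t] by (auto simp: c_def less_Suc_eq)
    qed simp
    have "H (f t) t n = H c t n" for t n
      by (auto simp: H_def fc)
    then have ns: "\<not> sep (\<lambda>n. g n ` H c t n)" for t using f(1)[of t] by simp
    define p where "p n = (\<lambda>k. c (prod_encode (n, k)))" for n
    have nbhd: "\<exists>t. \<forall>t'\<ge>t. H c t' n \<subseteq> W" if W: "open W" "p n \<in> W" for W n
    proof -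
      obtain X where X: "p n \<in> Pi\<^sub>E UNIV X" "finite {i. X i \<noteq> UNIV}" "Pi\<^sub>E UNIV X \<subseteq> W"
        using product_topology_open_contains_basis[OF W(1)[unfolded open_fun_def] W(2)] by auto
      define t where "t = Suc (Max (insert 0 ((\<lambda>k. prod_encode (n, k)) ` {i. X i \<noteq> UNIV})))"
      have t: "prod_encode (n, k) < t" if "X k \<noteq> UNIV" for k
        unfolding t_def less_Suc_eq_le by (rule Max_ge) (use X(2) that in auto)
      have "H c t' n \<subseteq> W" if "t' \<ge> t" for t'
      proof
        fix h assume h: "h \<in> H c t' n"
        have "h k \<in> X k" for k
        proof (cases "X k = UNIV")
          case False
          then have "h k = p n k" using h t[OF False] that by (auto simp: H_def p_def)
          then show ?thesis using X(1) by auto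
        qed auto
        then show "h \<in> W" using X(3) by (auto simp: PiE_def)
      qed
      then show ?thesis by blast
    qed
    \<comment> \<open>An empty member is separated trivially, by the empty set at its own index and
      the whole space at all others.\<close>
    have ne: "H c t n \<noteq> {}" for t n
    proof
      assume e: "H c t n = {}"
      have "g i ` H c t i \<subseteq> space N" for i using gsp by (auto simp: H_def)
      then have "sep (\<lambda>n. g n ` H c t n)"
        unfolding sep_def using e
        by (intro exI[of _ "\<lambda>i. if i = n then {} else space N"]) (auto split: if_splits)
      with ns show False by blast
    qed
    have pF: "p n \<in> F n" for n
    proof (rule ccontr)
      assume "p n \<notin> F n"
      then obtain t where "H c t n \<subseteq> - F n"
        using nbhd[of "- F n" n] F(1)[of n] by (metis ComplI open_Compl order_refl)
      then show False using ne[of t n] by (auto simp: H_def)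
    qed
    have shrink: "\<exists>t. \<forall>t'\<ge>t. g n ` H c t' n \<subseteq> U" if U: "openin T U" "g n (p n) \<in> U" for U n
    proof -
      have "openin (top_of_set (F n)) {h \<in> F n. g n h \<in> U}"
        using F(2)[of n] U by (auto simp: continuous_map_def)
      then obtain W where W: "open W" "{h \<in> F n. g n h \<in> U} = F n \<inter> W"
        by (auto simp: openin_open)
      then have "p n \<in> W" using pF U by blast
      from nbhd[OF W(1) this] obtain t where "\<forall>t'\<ge>t. H c t' n \<subseteq> W" ..
      then have "\<forall>t'\<ge>t. g n ` H c t' n \<subseteq> U" using W(2) by (auto simp: H_def)
      then show ?thesis ..
    qed
    \<comment> \<open>If two limit points differ, disjoint open sets around them contain the images
      at a late stage. These two sets, with the whole space at every other index, separate that
      stage.\<close>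
    have "g n (p n) = g 0 (p 0)" for n
    proof (rule ccontr)
      assume neq: "g n (p n) \<noteq> g 0 (p 0)"
      then have n0: "n \<noteq> 0" by metis
      obtain U V where UV: "openin T U" "openin T V" "U \<in> sets N" "V \<in> sets N"
          "g n (p n) \<in> U" "g 0 (p 0) \<in> V" "U \<inter> V = {}"
        using haus[OF gsp[OF pF[of n]] gsp[OF pF[of 0]] neq] by blast
      obtain t1 t2 where t: "\<forall>t'\<ge>t1. g n ` H c t' n \<subseteq> U" "\<forall>t'\<ge>t2. g 0 ` H c t' 0 \<subseteq> V"
        using shrink[OF UV(1,5)] shrink[OF UV(2,6)] by blast
      let ?t = "max t1 t2"
      have "g i ` H c ?t i \<subseteq> space N" for i using gsp by (auto simp: H_def)
      moreover have "g n ` H c ?t n \<subseteq> U" "g 0 ` H c ?t 0 \<subseteq> V" using t by simp_all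
      moreover have "(\<Inter>i. if i = n then U else if i = 0 then V else space N) \<subseteq> U \<inter> V"
      proof
        fix x assume x: "x \<in> (\<Inter>i. if i = n then U else if i = 0 then V else space N)"
        show "x \<in> U \<inter> V" using INT_D[OF x, of n] INT_D[OF x, of 0] n0 by simp
      qed
      ultimately have "sep (\<lambda>n. g n ` H c ?t n)"
        unfolding sep_def using UV n0
        by (intro exI[of _ "\<lambda>i. if i = n then U else if i = 0 then V else space N"]) (auto split: if_splits)
      with ns show False by blast
    qed
    then have "g 0 (p 0) \<in> A n" for n
      using F(3)[of n] pF[of n] by (metis imageI)
    then show False using disj by blast
  qed
  then show ?thesis using that unfolding sep_def by blast
qed

section \<open>Borel sets with finite sections\<close>

text \<open>A complete metric and a dense sequence are fixed so that points can be coded by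
  sequences of indices. Since \<open>q\<close> takes values in \<open>X\<close>, the space is
  nonempty here; the empty space is treated apart in the final proof.\<close>

locale polish_borel = Metric_space X d for X :: "'a set" and d :: "'a \<Rightarrow> 'a \<Rightarrow> real" +
  fixes M :: "'a measure" and q :: "nat \<Rightarrow> 'a"
  assumes complete: mcomplete
    and q_in [simp]: "\<And>n. q n \<in> X"
    and dense: "\<And>x e. x \<in> X \<Longrightarrow> 0 < e \<Longrightarrow> \<exists>n. d (q n) x < e"
    and space_M: "space M = X"
    and sets_M: "sets M = sigma_sets X {U. openin mtopology U}"
begin

lemma openin_sets: "openin mtopology U \<Longrightarrow> U \<in> sets M"
  unfolding sets_M by auto

lemma mball_sets [measurable]: "mball x r \<in> sets M"
  by (rule openin_sets) (rule openin_mball)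

text \<open>A Cauchy condition with a prescribed rate. Each instance involves only two terms, which
  makes the condition closed in the coordinates and Borel in a parameter, and the rate controls the
  distance of every single term from the limit.\<close>

definition regular :: "(nat \<Rightarrow> 'a) \<Rightarrow> bool" where
  "regular p \<longleftrightarrow> (\<forall>k l. d (p k) (p l) \<le> inverse (Suc k) + inverse (Suc l))"

text \<open>Unspecified unless \<open>p\<close> is regular.\<close>

definition rlim :: "(nat \<Rightarrow> 'a) \<Rightarrow> 'a" where
  "rlim p = (SOME x. x \<in> X \<and> (\<forall>k. d (p k) x \<le> inverse (Suc k)))"

lemma regularI:
  assumes "\<And>k. p k \<in> X" "x \<in> X" "\<And>k. d (p k) x \<le> inverse (Suc k)"
  shows "regular p"
  unfolding regular_def
proof (intro allI)
  fix k l
  have "d (p k) (p l) \<le> d (p k) x + d (p l) x" using assms triangle commute by metis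
  then show "d (p k) (p l) \<le> inverse (Suc k) + inverse (Suc l)" using assms(3)[of k] assms(3)[of l] by linarith
qed

lemma rlim:
  assumes p: "\<And>k. p k \<in> X" and reg: "regular p"
  shows "rlim p \<in> X" "d (p k) (rlim p) \<le> inverse (Suc k)"
proof -
  have "MCauchy p"
    unfolding MCauchy_def
  proof (intro conjI allI impI)
    fix e :: real assume "e > 0"
    then obtain N where N: "inverse (real (Suc N)) < e / 2"
      using reals_Archimedean[of "e/2"] by auto
    have "d (p n) (p n') < e" if "N \<le> n" "N \<le> n'" for n n'
    proof -
      have "inverse (real (Suc n)) \<le> inverse (real (Suc N))" "inverse (real (Suc n')) \<le> inverse (real (Suc N))"
        using that by (auto intro!: le_imp_inverse_le)
      then show ?thesis using reg[unfolded regular_def, rule_format, of n n'] N by linarith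
    qed
    then show "\<exists>N. \<forall>n n'. N \<le> n \<longrightarrow> N \<le> n' \<longrightarrow> d (p n) (p n') < e" by blast
  qed (use p in auto)
  then obtain x where x: "limitin mtopology p x sequentially"
    using complete by (auto simp: mcomplete_def)
  then have xX: "x \<in> X" by (simp add: limit_metric_sequentially)
  have "d (p k) x \<le> inverse (Suc k)" for k
  proof (rule field_le_epsilon)
    fix e :: real assume e: "e > 0"
    obtain N1 where N1: "\<And>n. n \<ge> N1 \<Longrightarrow> d (p n) x < e / 2"
      using x e unfolding limit_metric_sequentially by (metis half_gt_zero)
    obtain N2 where N2: "inverse (real (Suc N2)) < e / 2"
      using reals_Archimedean[of "e/2"] e by auto
    let ?n = "max N1 N2"
    have "inverse (real (Suc ?n)) \<le> inverse (real (Suc N2))"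
      by (intro le_imp_inverse_le) auto
    moreover have "d (p k) (p ?n) \<le> inverse (Suc k) + inverse (Suc ?n)"
      using reg by (auto simp: regular_def)
    moreover have "d (p k) x \<le> d (p k) (p ?n) + d (p ?n) x"
      using triangle p xX by blast
    ultimately show "d (p k) x \<le> inverse (Suc k) + e"
      using N1[of ?n] N2 by linarith
  qed
  then have "\<exists>x. x \<in> X \<and> (\<forall>k. d (p k) x \<le> inverse (Suc k))" using xX by blast
  from someI_ex[OF this] show "rlim p \<in> X" "d (p k) (rlim p) \<le> inverse (Suc k)"
    unfolding rlim_def by blast+
qed

lemma dist_zeroI:
  assumes "x \<in> X" "y \<in> X" "\<And>k::nat. d x y \<le> 2 * inverse (Suc k)"
  shows "x = y"
proof (rule ccontr)
  assume "x \<noteq> y"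
  then have "d x y > 0" using assms by simp
  then obtain k where "inverse (real (Suc k)) < d x y / 2"
    using reals_Archimedean[of "d x y / 2"] by auto
  then show False using assms(3)[of k] by linarith
qed

lemma rlim_eqI:
  assumes p: "\<And>k. p k \<in> X" and x: "x \<in> X" "\<And>k. d (p k) x \<le> inverse (Suc k)"
  shows "rlim p = x"
proof (rule dist_zeroI)
  note r = rlim[OF p regularI[OF p x]]
  show "rlim p \<in> X" by (rule r)
  show "d (rlim p) x \<le> 2 * inverse (Suc k)" for k
    using triangle[OF r(1) p[of k] x(1)] r(2)[of k] x(2)[of k] commute[of "rlim p" "p k"] by linarith
qed (rule x)

text \<open>Together with \<open>rlim\<close> this reduces membership of the limit in an open set to
  a condition on one term, which is why the limit depends continuously, or measurably, on the
  sequence.\<close>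

lemma rlim_approx:
  assumes p: "\<And>k. p k \<in> X" and reg: "regular p" and U: "openin mtopology U" "rlim p \<in> U"
  obtains k where "mcball (p k) (inverse (Suc k)) \<subseteq> U"
proof -
  obtain r where r: "r > 0" "mball (rlim p) r \<subseteq> U"
    using U by (auto simp: openin_mtopology)
  obtain k where k: "inverse (real (Suc k)) < r / 2"
    using reals_Archimedean[of "r/2"] r by auto
  have "mcball (p k) (inverse (Suc k)) \<subseteq> mball (rlim p) r"
  proof
    fix y assume "y \<in> mcball (p k) (inverse (Suc k))"
    then have y: "y \<in> X" "d (p k) y \<le> inverse (Suc k)" by auto
    have "d (rlim p) y \<le> d (rlim p) (p k) + d (p k) y"
      using triangle rlim(1)[OF p reg] p y(1) by blast
    then show "y \<in> mball (rlim p) r"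
      using y k rlim(1)[OF p reg] commute[of "rlim p" "p k"] rlim(2)[OF p reg, of k]
      unfolding in_mball by linarith
  qed
  then show ?thesis using that r(2) by blast
qed

text \<open>The codes are the index sequences \<open>y\<close> for which \<open>q (y k)\<close> is
  regular in \<open>k\<close>. A violation of regularity shows in two coordinates, so the codes form
  a closed set; density of \<open>q\<close> gives every point a code.\<close>

lemma analytic_in_carrier: "analytic_in mtopology X"
proof -
  define F where "F = {y :: nat \<Rightarrow> nat. regular (\<lambda>k. q (y k))}"
  let ?g = "\<lambda>y. rlim (\<lambda>k. q (y k))"
  have "- F = (\<Union>k. \<Union>l. \<Union>(a, b) \<in> {(a, b). \<not> d (q a) (q b) \<le> inverse (Suc k) + inverse (Suc l)}.
      {y. y k = a} \<inter> {y. y l = b})"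
    by (auto simp: F_def regular_def)
  also have "open \<dots>"
    by (intro open_UN ballI) (auto intro!: open_Int open_coordinate_eq)
  finally have "closed F" by (simp add: closed_def)
  moreover have "continuous_map (top_of_set F) mtopology ?g"
    unfolding continuous_map_def
  proof (intro conjI allI impI)
    show "?g \<in> topspace (top_of_set F) \<rightarrow> topspace mtopology"
      using rlim(1) by (auto simp: F_def)
    fix U assume U: "openin mtopology U"
    let ?S = "{y \<in> F. ?g y \<in> U}"
    let ?W = "\<Union>(k, a) \<in> {(k, a). mcball (q a) (inverse (Suc k)) \<subseteq> U}. {y :: nat \<Rightarrow> nat. y k = a}"
    have "open ?W" by (intro open_UN ballI) (auto intro!: open_coordinate_eq)
    moreover have "?S = F \<inter> ?W"
    proof (intro equalityI subsetI)
      fix y assume y: "y \<in> ?S"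
      then obtain k where "mcball (q (y k)) (inverse (Suc k)) \<subseteq> U"
        using rlim_approx[of "\<lambda>k. q (y k)" U] U by (auto simp: F_def)
      then show "y \<in> F \<inter> ?W" using y by auto
    next
      fix y assume y: "y \<in> F \<inter> ?W"
      then obtain k where k: "mcball (q (y k)) (inverse (Suc k)) \<subseteq> U" by auto
      have "?g y \<in> mcball (q (y k)) (inverse (Suc k))"
        using rlim[of "\<lambda>k. q (y k)"] y by (auto simp: F_def)
      then show "y \<in> ?S" using k y by auto
    qed
    ultimately show "openin (top_of_set F) {x \<in> topspace (top_of_set F). ?g x \<in> U}"
      by (auto simp: openin_open)
  qed
  moreover have "?g ` F = X"
  proof (intro equalityI subsetI)
    fix x assume x: "x \<in> X"
    have "\<exists>a. d (q a) x < inverse (Suc k)" for k by (rule dense[OF x]) simp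
    then obtain y where y: "\<And>k. d (q (y k)) x < inverse (Suc k)" by metis
    have "y \<in> F" "?g y = x"
      using regularI[of "\<lambda>k. q (y k)" x] rlim_eqI[of "\<lambda>k. q (y k)" x] x y
      by (auto simp: F_def less_imp_le)
    then show "x \<in> ?g ` F" by blast
  qed (use rlim(1) in \<open>auto simp: F_def\<close>)
  ultimately show ?thesis unfolding analytic_in_def by blast
qed

section \<open>Borel sets of the space and of its square are analytic\<close>

lemma metrizable_mtopology: "metrizable_space mtopology"
  unfolding metrizable_space_def using Metric_space_axioms by blast

lemma analytic_in_sets:
  assumes "A \<in> sets M"
  shows "analytic_in mtopology A"
proof (rule analytic_in_sigma_sets)
  show "A \<in> sigma_sets (topspace mtopology) {U. openin mtopology U}"
    using assms by (simp add: sets_M)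
  show "analytic_in mtopology (topspace mtopology - U)" if "U \<in> {U. openin mtopology U}" for U
  proof -
    have "closedin mtopology (topspace mtopology - U)" using that by blast
    from analytic_in_Int_closedin[OF analytic_in_carrier this] show ?thesis
      by (simp add: Int_Diff Int_absorb1)
  qed
qed (use Hausdorff_space_mtopology analytic_in_carrier analytic_in_openin[OF metrizable_mtopology] in auto)

abbreviation "mtopology2 \<equiv> prod_topology mtopology mtopology"

lemma Hausdorff_space_mtopology2: "Hausdorff_space mtopology2"
  using Hausdorff_space_mtopology by (simp add: Hausdorff_space_prod_topology)

text \<open>Working from measurable rectangles avoids comparing the product sigma-algebra with the
  Borel sets of the product topology. The complement of a rectangle is a union of two
  rectangles.\<close>

lemma analytic_in_sets_pair:
  assumes "A \<in> sets (M \<Otimes>\<^sub>M M)"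
  shows "analytic_in mtopology2 A"
proof (rule analytic_in_sigma_sets)
  show "A \<in> sigma_sets (topspace mtopology2) {a \<times> b |a b. a \<in> sets M \<and> b \<in> sets M}"
    using assms by (simp add: sets_pair_measure space_M)
  show "analytic_in mtopology2 R" if "R \<in> {a \<times> b |a b. a \<in> sets M \<and> b \<in> sets M}" for R
    using that analytic_in_Times analytic_in_sets by blast
  show "analytic_in mtopology2 (topspace mtopology2 - R)" if R: "R \<in> {a \<times> b |a b. a \<in> sets M \<and> b \<in> sets M}" for R
  proof -
    obtain a b where ab: "R = a \<times> b" "a \<in> sets M" "b \<in> sets M" using R by blast
    have "X - a \<in> sets M" "X - b \<in> sets M" "X \<in> sets M" using ab sets.compl_sets sets.top space_M by metis+
    then have "analytic_in mtopology2 ((X - a) \<times> X \<union> X \<times> (X - b))"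
      by (intro analytic_in_Un analytic_in_Times analytic_in_sets)
    moreover have "topspace mtopology2 - R = (X - a) \<times> X \<union> X \<times> (X - b)" using ab by auto
    ultimately show ?thesis by simp
  qed
  show "analytic_in mtopology2 (topspace mtopology2)"
    using analytic_in_Times[OF analytic_in_carrier analytic_in_carrier] by simp
qed (rule Hausdorff_space_mtopology2)

lemma analytic_in_fst: "analytic_in mtopology2 A \<Longrightarrow> analytic_in mtopology (fst ` A)"
  using analytic_in_image[OF _ continuous_map_fst] .

section \<open>Separation of analytic sets and lifting along graphs of functions\<close>

lemma disjoint_open_sets:
  assumes "x \<in> space M" "y \<in> space M" "x \<noteq> y"
  shows "\<exists>U V. openin mtopology U \<and> openin mtopology V \<and> U \<in> sets M \<and> V \<in> sets M \<and> x \<in> U \<and> y \<in> V \<and> U \<inter> V = {}"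
proof -
  have "\<exists>U V. openin mtopology U \<and> openin mtopology V \<and> x \<in> U \<and> y \<in> V \<and> U \<inter> V = {}"
    using Hausdorff_space_mtopology assms unfolding Hausdorff_space_def disjnt_def by (auto simp: space_M)
  then show ?thesis using openin_sets by blast
qed

text \<open>This is the point separation that \<open>Novikov_separation\<close> demands for the
  square; cylinders over a coordinate in which the two points differ do it.\<close>

lemma disjoint_open_sets_pair:
  assumes "u \<in> space (M \<Otimes>\<^sub>M M)" "v \<in> space (M \<Otimes>\<^sub>M M)" "u \<noteq> v"
  shows "\<exists>U V. openin mtopology2 U \<and> openin mtopology2 V \<and> U \<in> sets (M \<Otimes>\<^sub>M M) \<and> V \<in> sets (M \<Otimes>\<^sub>M M)
           \<and> u \<in> U \<and> v \<in> V \<and> U \<inter> V = {}"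
proof -
  obtain x y x' y' where uv: "u = (x, y)" "v = (x', y')" by (metis surj_pair)
  have sp: "x \<in> space M" "y \<in> space M" "x' \<in> space M" "y' \<in> space M"
    using assms uv by (auto simp: space_pair_measure)
  have X: "openin mtopology X" "X \<in> sets M" using openin_topspace[of mtopology] openin_sets by auto
  show ?thesis
  proof (cases "x = x'")
    case False
    then obtain U V where "openin mtopology U" "openin mtopology V" "U \<in> sets M" "V \<in> sets M" "x \<in> U" "x' \<in> V" "U \<inter> V = {}"
      using disjoint_open_sets[OF sp(1) sp(3) False] by blast
    then show ?thesis using X sp uv
      by (intro exI[of _ "U \<times> X"] exI[of _ "V \<times> X"]) (auto simp: openin_prod_Times_iff space_M)
  next
    case True
    then have "y \<noteq> y'" using assms uv by auto
    then obtain U V where "openin mtopology U" "openin mtopology V" "U \<in> sets M" "V \<in> sets M" "y \<in> U" "y' \<in> V" "U \<inter> V = {}"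
      using disjoint_open_sets[OF sp(2) sp(4) \<open>y \<noteq> y'\<close>] by blast
    then show ?thesis using X sp uv
      by (intro exI[of _ "X \<times> U"] exI[of _ "X \<times> V"]) (auto simp: openin_prod_Times_iff space_M)
  qed
qed

text \<open>Novikov separation is applied to the sequence \<open>A, B, B, ...\<close>: a point of
  \<open>B\<close> in the separator of \<open>A\<close> would lie in all the separators.\<close>

lemma separation_two:
  assumes A: "analytic_in mtopology A" "analytic_in mtopology B" "A \<inter> B = {}"
  obtains S where "S \<in> sets M" "A \<subseteq> S" "S \<inter> B = {}"
proof -
  obtain C where C: "\<And>n::nat. C n \<in> sets M" "\<And>n. (if n = 0 then A else B) \<subseteq> C n" "(\<Inter>n. C n) = {}"
  proof -
    have e: "(\<Inter>n::nat. if n = 0 then A else B) = {}"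
      using A(3) by (auto split: if_splits)
    have a: "analytic_in mtopology (if n = 0 then A else B)" for n :: nat
      using A by simp
    have t: "topspace mtopology = space M" by (simp add: space_M)
    show ?thesis
      by (rule Novikov_separation[OF t disjoint_open_sets a e]) (assumption | rule that)+
  qed
  have "x \<notin> C 0" if x: "x \<in> B" for x
  proof
    assume x0: "x \<in> C 0"
    have "x \<in> C n" for n
      using C(2)[of n] x x0 by (cases "n = 0") auto
    then have "x \<in> (\<Inter>n. C n)" by simp
    then show False unfolding C(3) by simp
  qed
  then have "C 0 \<inter> B = {}" by fast
  then show ?thesis using that[of "C 0"] C(1,2)[of 0] by auto
qed

text \<open>If \<open>G\<close> is the graph of a partial function g, the composite of \<phi> with g
  lives on the domain of g, which is not yet known to be Borel. Its level sets are pairwise disjoint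
  analytic sets, and separating them yields a Borel function on the whole space that agrees with it
  on the domain.\<close>

lemma single_valued_lift:
  fixes \<phi> :: "'a \<Rightarrow> nat"
  assumes G: "G \<in> sets (M \<Otimes>\<^sub>M M)" "single_valued G" and \<phi>: "\<phi> \<in> M \<rightarrow>\<^sub>M count_space UNIV"
  obtains \<psi> where "\<psi> \<in> M \<rightarrow>\<^sub>M count_space UNIV" "\<And>x y. (x, y) \<in> G \<Longrightarrow> \<psi> x = \<phi> y"
proof -
  have GX: "G \<subseteq> X \<times> X" using sets.sets_into_space[OF G(1)] by (auto simp: space_pair_measure space_M)
  define A where "A i = fst ` (G \<inter> X \<times> {y \<in> X. \<phi> y = i})" for i
  have "{y \<in> space M. \<phi> y = i} \<in> sets M" for i
    using \<phi> by measurable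
  then have A: "analytic_in mtopology (A i)" for i
    unfolding A_def using G(1) sets.top[of M]
    by (intro analytic_in_fst analytic_in_sets_pair sets.Int pair_measureI) (auto simp: space_M)
  have disj: "A i \<inter> A j = {}" if "i \<noteq> j" for i j
    using that G(2) unfolding A_def single_valued_def by force
  have "\<exists>S. S \<in> sets M \<and> A i \<subseteq> S \<and> S \<inter> A j = {}" if "i \<noteq> j" for i j
    by (rule separation_two[OF A A disj[OF that]]) blast
  then obtain S where S: "\<And>i j. i \<noteq> j \<Longrightarrow> S i j \<in> sets M \<and> A i \<subseteq> S i j \<and> S i j \<inter> A j = {}"
    by metis
  define S' where "S' i = (\<Inter>j. if j = i then space M else S i j)" for i
  have S'm [measurable]: "S' i \<in> sets M" for i
    unfolding S'_def using S by (intro sets.countable_INT) auto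
  have S'A: "A i \<subseteq> S' i" for i
  proof -
    have "A i \<subseteq> space M" using GX by (auto simp: A_def space_M)
    then show ?thesis unfolding S'_def by (intro INT_greatest) (use S in auto)
  qed
  have S'd: "S' i \<inter> A j = {}" if "i \<noteq> j" for i j
  proof -
    have "S' i \<subseteq> S i j" using INT_lower[of j UNIV "\<lambda>j. if j = i then space M else S i j"] that
      by (simp add: S'_def)
    then show ?thesis using S[OF that] by blast
  qed
  \<comment> \<open>On the domain of \<open>G\<close> exactly one \<open>i\<close> qualifies;
    elsewhere any value is acceptable as long as the function stays measurable.\<close>
  define \<psi> where "\<psi> x = (LEAST i. x \<in> S' i)" for x
  show ?thesis
  proof
    show "\<psi> \<in> M \<rightarrow>\<^sub>M count_space UNIV"
      unfolding \<psi>_def by measurable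
    fix x y assume xy: "(x, y) \<in> G"
    then have "x \<in> A (\<phi> y)" using GX by (force simp: A_def)
    then have "x \<in> S' i \<longleftrightarrow> i = \<phi> y" for i using S'A[of "\<phi> y"] S'd[of i "\<phi> y"] by blast
    then show "\<psi> x = \<phi> y" unfolding \<psi>_def by (intro Least_equality) auto
  qed
qed

section \<open>A countable base and Borel projections\<close>

definition base_set :: "nat \<Rightarrow> 'a set" where
  "base_set n = (case prod_decode n of (i, m) \<Rightarrow> mball (q i) (inverse (Suc m)))"

lemma base_set_sets [measurable]: "base_set n \<in> sets M"
  by (simp add: base_set_def split: prod.split)

lemma base_set_separates:
  assumes C: "finite C" and x: "x \<in> X" "x \<notin> C"
  obtains n where "x \<in> base_set n" "base_set n \<inter> C = {}"
proof -
  \<comment> \<open>The \<open>1\<close> keeps the minimum meaningful when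
    \<open>C \<inter> X\<close> is empty. Points of \<open>C\<close> outside \<open>X\<close> may be
    ignored because balls lie in \<open>X\<close>.\<close>
  define e where "e = Min (insert 1 (d x ` (C \<inter> X)))"
  have "e > 0" unfolding e_def using C x by (subst Min_gr_iff) auto
  then obtain m where m: "inverse (real (Suc m)) < e / 2"
    using reals_Archimedean[of "e/2"] by auto
  obtain i where i: "d (q i) x < inverse (Suc m)"
    using dense[OF x(1), of "inverse (Suc m)"] by auto
  have "y \<notin> mball (q i) (inverse (Suc m))" if y: "y \<in> C" for y
  proof
    assume "y \<in> mball (q i) (inverse (Suc m))"
    then have y': "y \<in> X" "d (q i) y < inverse (Suc m)" by auto
    have "e \<le> d x y" unfolding e_def using C y y' by (intro Min_le) auto
    moreover have "d x y \<le> d x (q i) + d (q i) y" using triangle x y' by simp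
    ultimately show False using i m y' commute[of x "q i"] by linarith
  qed
  then have "mball (q i) (inverse (Suc m)) \<inter> C = {}" by blast
  then show ?thesis
    using that[of "prod_encode (i, m)"] i x by (simp add: base_set_def)
qed

text \<open>The value at \<open>x\<close> is coded by indices of balls that contain it. Lifting each
  index to a Borel function on the whole space and taking limits extends the partial function to a
  Borel map \<open>g\<close>; the domain is then the Borel set of those \<open>x\<close> with
  \<open>(x, g x) \<in> G\<close>.\<close>

lemma single_valued_domain_sets:
  assumes G: "G \<in> sets (M \<Otimes>\<^sub>M M)" "single_valued G"
  shows "fst ` G \<in> sets M"
proof -
  have GX: "G \<subseteq> X \<times> X" using sets.sets_into_space[OF G(1)] by (auto simp: space_pair_measure space_M)
  define \<phi> where "\<phi> m y = (LEAST i. y \<in> mball (q i) (inverse (Suc m)))" for m y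
  have \<phi>: "y \<in> mball (q (\<phi> m y)) (inverse (Suc m))" if y: "y \<in> X" for m y
  proof -
    obtain i where "d (q i) y < inverse (Suc m)"
      using dense[OF y, of "inverse (Suc m)"] by auto
    then have "y \<in> mball (q i) (inverse (Suc m))" using y by simp
    then show ?thesis unfolding \<phi>_def by (rule LeastI)
  qed
  have "\<phi> m \<in> M \<rightarrow>\<^sub>M count_space UNIV" for m
    unfolding \<phi>_def by measurable
  then have "\<exists>\<psi>. \<psi> \<in> M \<rightarrow>\<^sub>M count_space UNIV \<and> (\<forall>x y. (x, y) \<in> G \<longrightarrow> \<psi> x = \<phi> m y)" for m
    by (rule single_valued_lift[OF G]) blast
  then obtain \<psi> where \<psi>m [measurable]: "\<And>m. \<psi> m \<in> M \<rightarrow>\<^sub>M count_space UNIV"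
    and \<psi>: "\<And>m x y. (x, y) \<in> G \<Longrightarrow> \<psi> m x = \<phi> m y"
    by metis
  define D where "D = {x \<in> space M. regular (\<lambda>m. q (\<psi> m x))}"
  \<comment> \<open>Off \<open>D\<close> the lifted indices need not converge, so the default
    \<open>q 0\<close> keeps \<open>g\<close> total with values in \<open>X\<close>.\<close>
  define g where "g x = (if x \<in> D then rlim (\<lambda>m. q (\<psi> m x)) else q 0)" for x
  have Dm [measurable]: "D \<in> sets M"
    unfolding D_def regular_def by measurable
  have "g \<in> M \<rightarrow>\<^sub>M M"
  proof (rule measurable_sigma_sets)
    show "sets M = sigma_sets X {U. openin mtopology U}" by (rule sets_M)
    show "{U. openin mtopology U} \<subseteq> Pow X" using openin_subset by fastforce
    show "g \<in> space M \<rightarrow> X" by (auto simp: g_def D_def intro!: rlim(1))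
    fix U assume "U \<in> {U. openin mtopology U}"
    then have U: "openin mtopology U" by simp
    let ?E = "{x \<in> space M. \<exists>m. mcball (q (\<psi> m x)) (inverse (Suc m)) \<subseteq> U}"
    have "?E = (\<Union>m. \<psi> m -` {i. mcball (q i) (inverse (Suc m)) \<subseteq> U} \<inter> space M)" by auto
    also have "\<dots> \<in> sets M"
      by (intro sets.countable_UN image_subsetI measurable_sets[OF \<psi>m]) simp
    finally have "?E \<in> sets M" .
    moreover have "g -` U \<inter> space M = (D \<inter> ?E) \<union> (if q 0 \<in> U then space M - D else {})"
    proof (intro equalityI subsetI)
      fix x assume x: "x \<in> g -` U \<inter> space M"
      show "x \<in> (D \<inter> ?E) \<union> (if q 0 \<in> U then space M - D else {})"
      proof (cases "x \<in> D")
        case True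
        then have "rlim (\<lambda>m. q (\<psi> m x)) \<in> U" "regular (\<lambda>m. q (\<psi> m x))" using x by (auto simp: g_def D_def)
        then obtain k where "mcball (q (\<psi> k x)) (inverse (Suc k)) \<subseteq> U"
          using rlim_approx[of "\<lambda>m. q (\<psi> m x)" U] U by auto
        then show ?thesis using True x by blast
      next
        case False
        then have "q 0 \<in> U" using x by (simp add: g_def)
        then show ?thesis using False x by simp
      qed
    next
      fix x assume x: "x \<in> (D \<inter> ?E) \<union> (if q 0 \<in> U then space M - D else {})"
      show "x \<in> g -` U \<inter> space M"
      proof (cases "x \<in> D")
        case True
        then obtain m where m: "mcball (q (\<psi> m x)) (inverse (Suc m)) \<subseteq> U"
          using x by (auto split: if_splits)
        have "regular (\<lambda>m. q (\<psi> m x))" using True by (simp add: D_def)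
        from rlim[of "\<lambda>m. q (\<psi> m x)", OF q_in this]
        have "rlim (\<lambda>m. q (\<psi> m x)) \<in> mcball (q (\<psi> m x)) (inverse (Suc m))" by simp
        then show ?thesis using m True by (auto simp: g_def D_def)
      next
        case False
        then show ?thesis using x by (auto simp: g_def split: if_splits)
      qed
    qed
    ultimately show "g -` U \<inter> space M \<in> sets M" by auto
  qed
  then have "{x \<in> space M. (x, g x) \<in> G} \<in> sets M"
    using G(1) by measurable
  moreover have "fst ` G = {x \<in> space M. (x, g x) \<in> G}"
  proof (intro equalityI subsetI)
    fix x assume "x \<in> fst ` G"
    then obtain y where y: "(x, y) \<in> G" by auto
    then have X: "x \<in> X" "y \<in> X" using GX by auto
    have *: "d (q (\<psi> m x)) y \<le> inverse (Suc m)" for m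
      using \<phi>[OF X(2), of m] \<psi>[OF y, of m] by simp
    have "regular (\<lambda>m. q (\<psi> m x))" by (rule regularI[OF _ X(2) *]) simp
    moreover have "rlim (\<lambda>m. q (\<psi> m x)) = y" by (rule rlim_eqI[OF _ X(2) *]) simp
    ultimately have "g x = y" using X by (simp add: g_def D_def space_M)
    then show "x \<in> {x \<in> space M. (x, g x) \<in> G}" using y X by (simp add: space_M)
  qed force
  ultimately show ?thesis by simp
qed

text \<open>Novikov separation writes a Borel set with finite sections as a countable union of graphs of
  Borel partial functions: \<open>A n\<close> consists of the points that \<open>base_set n\<close> does not isolate in their
  section.\<close>

lemma finite_section_domain_sets:
  assumes P: "P \<in> sets (M \<Otimes>\<^sub>M M)" and fin: "\<And>x. finite {y. (x, y) \<in> P}"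
  shows "fst ` P \<in> sets M"
proof -
  have PX: "P \<subseteq> X \<times> X" using sets.sets_into_space[OF P] by (auto simp: space_pair_measure space_M)
  have XM: "X \<in> sets M" using sets.top[of M] by (simp add: space_M)
  \<comment> \<open>A point (x, y) of \<open>P\<close> belongs to \<open>A n\<close> if y lies
    outside \<open>base_set n\<close>, or if \<open>base_set n\<close> contains another point of the
    section of x, told apart from y by some \<open>base_set m\<close>. In this form only products,
    projections and countable unions occur, so \<open>A n\<close> is visibly analytic.\<close>
  define A where "A n = P \<inter> X \<times> (X - base_set n) \<union>
    (\<Union>m. P \<inter> fst ` (P \<inter> X \<times> (base_set n - base_set m)) \<times> base_set m)" for n
  have "analytic_in mtopology2 (A n)" for n
    unfolding A_def
    by (intro analytic_in_Un analytic_in_UN analytic_in_Int[OF Hausdorff_space_mtopology2]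
        analytic_in_Times analytic_in_fst analytic_in_sets_pair[OF P] analytic_in_sets XM
        sets.Diff base_set_sets)
  \<comment> \<open>Here finiteness of the sections enters: each point of a section is isolated in
    it by some basic set.\<close>
  moreover have "(\<Inter>n. A n) = {}"
  proof (rule ccontr)
    assume "(\<Inter>n. A n) \<noteq> {}"
    then obtain x y where xy: "\<And>n. (x, y) \<in> A n" by auto
    then have "(x, y) \<in> P" by (auto simp: A_def)
    then have y: "y \<in> X" using PX by auto
    obtain n where n: "y \<in> base_set n" "base_set n \<inter> ({y. (x, y) \<in> P} - {y}) = {}"
      by (rule base_set_separates[of "{y. (x, y) \<in> P} - {y}" y]) (use fin y in auto)
    then have "(x, y) \<in> (\<Union>m. P \<inter> fst ` (P \<inter> X \<times> (base_set n - base_set m)) \<times> base_set m)"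
      using xy[of n] by (simp add: A_def)
    then obtain m y' where "(x, y') \<in> P" "y' \<in> base_set n" "y' \<notin> base_set m" "y \<in> base_set m"
      by auto
    then show False using n by blast
  qed
  ultimately obtain D where D: "\<And>n. D n \<in> sets (M \<Otimes>\<^sub>M M)" "\<And>n. A n \<subseteq> D n" "(\<Inter>n. D n) = {}"
    using Novikov_separation[of mtopology2 "M \<Otimes>\<^sub>M M" A, OF _ disjoint_open_sets_pair]
    by (auto simp: space_pair_measure space_M)
  \<comment> \<open>Outside \<open>D n\<close>, hence outside \<open>A n\<close>, every point is the
    only one of its section in the same \<open>base_set n\<close>.\<close>
  have "single_valued (P - D n)" for n
  proof (rule single_valuedI)
    fix x y y' assume y: "(x, y) \<in> P - D n" and y': "(x, y') \<in> P - D n"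
    show "y = y'"
    proof (rule ccontr)
      assume "y \<noteq> y'"
      moreover have X: "x \<in> X" "y \<in> X" "y' \<in> X" using y y' PX by auto
      ultimately obtain m where m: "y \<in> base_set m" "base_set m \<inter> {y'} = {}"
        using base_set_separates[of "{y'}" y] by auto
      have nA: "(x, y) \<notin> A n" "(x, y') \<notin> A n" using y y' D(2) by auto
      then have "y' \<in> base_set n" using y' X by (auto simp: A_def)
      then have "x \<in> fst ` (P \<inter> X \<times> (base_set n - base_set m))"
        using y' X m by (intro image_eqI[of _ _ "(x, y')"]) auto
      then have "(x, y) \<in> A n" using y m unfolding A_def by blast
      with nA show False by blast
    qed
  qed
  then have "fst ` (P - D n) \<in> sets M" for n
    using single_valued_domain_sets P D(1) by blast
  moreover have "fst ` P = (\<Union>n. fst ` (P - D n))"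
  proof -
    have "P = (\<Union>n. P - D n)" using D(3) by blast
    then show ?thesis by (metis image_UN)
  qed
  ultimately show ?thesis by auto
qed

end

section \<open>Borel colorings of locally finite Borel graphs\<close>

locale polish_graph = polish_borel X d M q
  for X :: "'a set" and d M q +
  fixes \<Gamma> :: "('a \<times> 'a) set"
  assumes Borel: "\<Gamma> \<in> sets (M \<Otimes>\<^sub>M M)"
    and sym: "sym \<Gamma>"
    and irrefl: "irrefl \<Gamma>"
    and locally_finite: "\<And>x. x \<in> X \<Longrightarrow> finite {y. (x, y) \<in> \<Gamma>}"
begin

lemma edge_in: "(x, y) \<in> \<Gamma> \<Longrightarrow> x \<in> X \<and> y \<in> X"
  using sets.sets_into_space[OF Borel] by (auto simp: space_pair_measure space_M)

lemma finite_neighbours: "finite {y. (x, y) \<in> \<Gamma>}"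
proof (cases "x \<in> X")
  case False
  then have "{y. (x, y) \<in> \<Gamma>} = {}" using edge_in by blast
  then show ?thesis by (simp only: finite.emptyI)
qed (rule locally_finite)

text \<open>By symmetry the neighbourhood of \<open>A\<close> is the first projection of the edges
  that end in \<open>A\<close>, a Borel set with finite sections.\<close>

lemma neighbours_sets [measurable]:
  assumes "A \<in> sets M"
  shows "\<Gamma> `` A \<in> sets M"
proof -
  have "X \<in> sets M" using sets.top[of M] by (simp add: space_M)
  then have "fst ` (\<Gamma> \<inter> X \<times> A) \<in> sets M"
    using finite_neighbours assms Borel
    by (intro finite_section_domain_sets sets.Int pair_measureI) auto
  moreover have "\<Gamma> `` A = fst ` (\<Gamma> \<inter> X \<times> A)"
    using edge_in symD[OF sym] by force
  ultimately show ?thesis by simp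
qed

text \<open>Removing from a basic set all neighbours of its points leaves an independent Borel set.
  These sets cover the space, since some basic set contains a given vertex and none of its finitely
  many neighbours.\<close>

lemma countable_Borel_coloring:
  obtains c where "c \<in> M \<rightarrow>\<^sub>M count_space (UNIV :: nat set)" "\<And>x y. (x, y) \<in> \<Gamma> \<Longrightarrow> c x \<noteq> c y"
proof
  define c where "c x = (LEAST n. x \<in> base_set n - \<Gamma> `` base_set n)" for x
  show "c \<in> M \<rightarrow>\<^sub>M count_space UNIV"
    unfolding c_def by measurable
  have c: "x \<in> base_set (c x) - \<Gamma> `` base_set (c x)" if x: "x \<in> X" for x
    unfolding c_def
  proof (rule LeastI_ex)
    have "x \<notin> {y. (x, y) \<in> \<Gamma>}" using irrefl by (simp add: irrefl_def)
    then obtain n where "x \<in> base_set n" "base_set n \<inter> {y. (x, y) \<in> \<Gamma>} = {}"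
      using base_set_separates[OF finite_neighbours x] by blast
    then show "\<exists>n. x \<in> base_set n - \<Gamma> `` base_set n"
      using symD[OF sym] by blast
  qed
  show "c x \<noteq> c y" if xy: "(x, y) \<in> \<Gamma>" for x y
    using c[of x] c[of y] edge_in[OF xy] xy by auto
qed

text \<open>These functions form a countable family of Borel functions, indexed by lists, that is
  rich enough to realize every coloring of a finite set.\<close>

fun list_color :: "(nat \<times> nat) list \<Rightarrow> 'a \<Rightarrow> nat" where
  "list_color [] x = 0"
| "list_color ((n, j) # L) x = (if x \<in> base_set n then j else list_color L x)"

lemma measurable_list_color [measurable]: "list_color L \<in> M \<rightarrow>\<^sub>M count_space UNIV"
proof (induction L)
  case Nil
  have "list_color [] = (\<lambda>_. 0)" by auto
  then show ?case by simp
next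
  case (Cons a L)
  obtain n j where a: "a = (n, j)" by (cases a)
  have "list_color (a # L) = (\<lambda>x. if x \<in> base_set n then j else list_color L x)"
    by (auto simp: a)
  then show ?case using Cons by simp
qed

lemma list_color_extends:
  assumes "finite C" "C \<subseteq> X"
  shows "\<exists>L. \<forall>x\<in>C. list_color L x = c x"
  using assms
proof (induction rule: finite_induct)
  case (insert a C)
  then obtain L where L: "\<forall>x\<in>C. list_color L x = c x" by auto
  obtain n where "a \<in> base_set n" "base_set n \<inter> C = {}"
    by (rule base_set_separates[of C a]) (use insert in auto)
  then have "\<forall>x\<in>insert a C. list_color ((n, c a) # L) x = c x"
    using L by auto
  then show ?case by blast
qed simp

text \<open>The coloring \<open>c\<close> is not assumed Borel; it only guarantees that on each
  finite component some \<open>list_color L\<close> is a proper coloring with values below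
  \<open>k\<close>. The first such list in a fixed enumeration is a Borel choice, because
  saturations of Borel sets are Borel.\<close>

lemma Borel_coloring_finite_components:
  assumes V [measurable]: "V \<in> sets M"
    and fin: "\<And>x. x \<in> V \<Longrightarrow> finite ((\<Gamma> \<inter> V \<times> V)\<^sup>* `` {x})"
    and c: "\<And>x. x \<in> X \<Longrightarrow> c x < k" "\<And>x y. (x, y) \<in> \<Gamma> \<Longrightarrow> c x \<noteq> c y"
  obtains f where "f \<in> M \<rightarrow>\<^sub>M count_space (UNIV :: nat set)" "\<And>x. x \<in> V \<Longrightarrow> f x < k"
    "\<And>x y. x \<in> V \<Longrightarrow> y \<in> V \<Longrightarrow> (x, y) \<in> \<Gamma> \<Longrightarrow> f x \<noteq> f y"
proof -
  let ?E = "\<Gamma> \<inter> V \<times> V"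
  have VX: "V \<subseteq> X" using sets.sets_into_space[OF V] by (simp add: space_M)
  have E_sets: "?E `` A \<in> sets M" if [measurable]: "A \<in> sets M" for A
  proof -
    have "?E `` A = V \<inter> \<Gamma> `` (V \<inter> A)" by auto
    then show ?thesis by simp
  qed
  have E_pow: "(?E ^^ n) `` A \<in> sets M" if "A \<in> sets M" for A n
    using that by (induction n) (auto simp: relcomp_Image intro: E_sets)
  have E_star: "?E\<^sup>* `` A \<in> sets M" if "A \<in> sets M" for A
  proof -
    have "?E\<^sup>* `` A = (\<Union>n. (?E ^^ n) `` A)" by (auto simp: rtrancl_is_UN_relpow)
    then show ?thesis using E_pow[OF that] by auto
  qed
  have symE: "sym (?E\<^sup>*)" using sym by (intro sym_rtrancl) (auto simp: sym_def)
  define P where "P L j = {x \<in> space M. list_color L x = j} \<inter> V" for L j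
  \<comment> \<open>The points of \<open>V\<close> at which \<open>L\<close> fails: the color is too
    large, or a neighbour in \<open>V\<close> has the same color. Its saturation \<open>B L\<close>
    consists of the components on which \<open>L\<close> is unusable.\<close>
  define S where "S L = (\<Union>j\<in>{k..}. P L j) \<union> (\<Union>j. P L j \<inter> \<Gamma> `` P L j)" for L
  have [measurable]: "P L j \<in> sets M" for L j unfolding P_def by measurable
  have [measurable]: "S L \<in> sets M" for L unfolding S_def by measurable
  define B where "B L = ?E\<^sup>* `` S L" for L
  have [measurable]: "B L \<in> sets M" for L unfolding B_def by (rule E_star) simp
  \<comment> \<open>As every \<open>B L\<close> is a union of components, \<open>n\<close> is
    constant on components, so adjacent points of \<open>V\<close> are colored by the same
    list.\<close>
  define n where "n x = (LEAST n. x \<notin> B (from_nat n))" for x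
  define f where "f x = list_color (from_nat (n x)) x" for x
  have n: "x \<notin> B (from_nat (n x))" if x: "x \<in> V" for x
    unfolding n_def
  proof (rule LeastI_ex)
    let ?C = "?E\<^sup>* `` {x}"
    have CV: "?C \<subseteq> V"
    proof
      fix y assume "y \<in> ?C"
      then have "(x, y) \<in> ?E\<^sup>*" by simp
      then show "y \<in> V" using x by cases auto
    qed
    then obtain L where L: "\<forall>y\<in>?C. list_color L y = c y"
      using list_color_extends[OF fin[OF x]] VX by blast
    have "x \<notin> B L"
    proof
      assume "x \<in> B L"
      then obtain y where y: "y \<in> S L" "(y, x) \<in> ?E\<^sup>*" by (auto simp: B_def)
      then have yC: "y \<in> ?C" using symE by (auto dest: symD)
      have yX: "y \<in> X" using yC CV VX by blast
      show False
        using y(1) unfolding S_def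
      proof
        assume "y \<in> (\<Union>j\<in>{k..}. P L j)"
        then have "k \<le> list_color L y" by (auto simp: P_def)
        then show False using L yC c(1)[OF yX] by auto
      next
        assume "y \<in> (\<Union>j. P L j \<inter> \<Gamma> `` P L j)"
        then obtain z where z: "z \<in> V" "y \<in> V" "(z, y) \<in> \<Gamma>" "list_color L z = list_color L y"
          by (auto simp: P_def)
        then have "(y, z) \<in> ?E" using symD[OF sym] by blast
        then have "z \<in> ?C" using yC by (auto intro: rtrancl_into_rtrancl)
        then show False using c(2)[OF z(3)] L yC z(4) by auto
      qed
    qed
    then show "\<exists>n. x \<notin> B (from_nat n)" by (metis from_nat_to_nat)
  qed
  have notS: "x \<notin> S (from_nat (n x))" if "x \<in> V" for x
    using n[OF that] by (auto simp: B_def)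
  show ?thesis
  proof
    have [measurable]: "n \<in> M \<rightarrow>\<^sub>M count_space UNIV" unfolding n_def by measurable
    show "f \<in> M \<rightarrow>\<^sub>M count_space UNIV"
      unfolding f_def by (rule measurable_compose_countable[of "\<lambda>i. list_color (from_nat i)"]) measurable
    show "f x < k" if "x \<in> V" for x
      using notS[OF that] that VX by (auto simp: S_def P_def f_def space_M not_le)
    show "f x \<noteq> f y" if xy: "x \<in> V" "y \<in> V" "(x, y) \<in> \<Gamma>" for x y
    proof
      assume eq: "f x = f y"
      have "(x, y) \<in> ?E\<^sup>*" "(y, x) \<in> ?E\<^sup>*" using xy symD[OF sym] by blast+
      then have "x \<in> B L \<longleftrightarrow> y \<in> B L" for L
        unfolding B_def by (blast intro: rtrancl_trans)
      then have "n x = n y" by (simp add: n_def)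
      then have "y \<in> P (from_nat (n y)) (f y) \<inter> \<Gamma> `` P (from_nat (n y)) (f y)"
        using xy eq VX by (auto simp: P_def f_def space_M)
      then show False using notS[OF xy(2)] by (auto simp: S_def)
    qed
  qed
qed

end

section \<open>Graph distance, relational powers and the scale relation\<close>

lemma graph_path_relpow:
  assumes "graph_path \<Gamma> x p y"
  shows "(x, y) \<in> \<Gamma> ^^ (length p - 1)"
  using assms
proof (induction p arbitrary: x)
  case (Cons a p)
  show ?case
  proof (cases p)
    case Nil
    then show ?thesis using Cons.prems by (auto simp: graph_path_def)
  next
    case p: (Cons b p')
    then have "graph_path \<Gamma> b p y" "(x, b) \<in> \<Gamma>" using Cons.prems by (auto simp: graph_path_def)
    then have "(x, y) \<in> \<Gamma> ^^ Suc (length p - 1)"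
      using Cons.IH by (blast intro: relpow_Suc_I2)
    then show ?thesis using p by simp
  qed
qed (simp add: graph_path_def)

text \<open>Paths have distinct vertices, walks do not: when the next vertex of the walk already
  lies on the path, the path is cut off there.\<close>

lemma relpow_graph_path:
  assumes "(x, y) \<in> \<Gamma> ^^ n"
  shows "\<exists>p. graph_path \<Gamma> x p y \<and> length p \<le> Suc n"
  using assms
proof (induction n arbitrary: y)
  case 0
  then have "graph_path \<Gamma> x [x] y" by (simp add: graph_path_def)
  then show ?case by fastforce
next
  case (Suc n)
  then obtain z where z: "(x, z) \<in> \<Gamma> ^^ n" "(z, y) \<in> \<Gamma>" by auto
  obtain p where p: "graph_path \<Gamma> x p z" "length p \<le> Suc n" using Suc.IH[OF z(1)] by blast
  show ?case
  proof (cases "y \<in> set p")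
    case True
    then obtain p1 p2 where "p = p1 @ y # p2" using split_list[of y p] by blast
    then have p12: "p = (p1 @ [y]) @ p2" by simp
    have "hd (p1 @ [y]) = x" using p(1) p12 by (cases p1) (auto simp: graph_path_def)
    moreover have "distinct (p1 @ [y])" "successively (\<lambda>u v. (u, v) \<in> \<Gamma>) (p1 @ [y])"
      using p(1) unfolding graph_path_def p12
      by (simp_all only: distinct_append successively_append_iff[of _ "p1 @ [y]" p2])
    ultimately have "graph_path \<Gamma> x (p1 @ [y]) y" by (simp add: graph_path_def)
    moreover have "length (p1 @ [y]) \<le> Suc (Suc n)" using p(2) p12 by simp
    ultimately show ?thesis by blast
  next
    case False
    then have "graph_path \<Gamma> x (p @ [y]) y"
      using p(1) z(2) by (auto simp: graph_path_def successively_append_iff)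
    then show ?thesis using p(2) by (intro exI[of _ "p @ [y]"]) simp
  qed
qed

lemma graph_metric_le_relpow:
  assumes "(x, y) \<in> \<Gamma> ^^ n"
  shows "graph_metric \<Gamma> x y \<le> of_nat n"
proof -
  obtain p where "graph_path \<Gamma> x p y" "length p \<le> Suc n"
    using relpow_graph_path[OF assms] by blast
  then show ?thesis
    unfolding graph_metric_def by (intro INF_lower2[of p]) auto
qed

lemma graph_metric_less_relpow:
  assumes "graph_metric \<Gamma> x y < of_nat n"
  shows "\<exists>m<n. (x, y) \<in> \<Gamma> ^^ m"
proof -
  obtain p where p: "graph_path \<Gamma> x p y" "(of_nat (length p - 1) :: ennreal) < of_nat n"
    using assms unfolding graph_metric_def INF_less_iff by blast
  then have "length p - 1 < n" by simp
  then show ?thesis using graph_path_relpow[OF p(1)] by blast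
qed

lemma equiv_scale_rel: "equiv U (scale_rel \<rho> r U)"
proof (rule equivI)
  define \<E> where "\<E> = {E. equiv U E \<and> (\<forall>x\<in>U. \<forall>y\<in>U. \<rho> x y \<le> ennreal r \<longrightarrow> (x, y) \<in> E)}"
  have R: "scale_rel \<rho> r U = \<Inter>\<E>"
    unfolding scale_rel_def \<E>_def ..
  have \<E>: "refl_on U E" "sym E" "trans E" if "E \<in> \<E>" for E
    using that by (auto simp: \<E>_def elim: equivE)
  \<comment> \<open>The family must be nonempty, since an empty intersection would be the universal
    relation.\<close>
  have "U \<times> U \<in> \<E>"
    by (auto simp: \<E>_def intro!: equivI refl_onI symI transI)
  then show "scale_rel \<rho> r U \<subseteq> U \<times> U"
    unfolding R by blast
  show "refl_on U (scale_rel \<rho> r U)"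
    unfolding R by (intro refl_onI InterI) (use \<E>(1) refl_onD in fast)
  show "sym (scale_rel \<rho> r U)"
    unfolding R by (intro symI InterI) (use \<E>(2) symD in fast)
  show "trans (scale_rel \<rho> r U)"
    unfolding R by (intro transI InterI) (use \<E>(3) transD in fast)
qed

lemma scale_rel_I:
  "x \<in> U \<Longrightarrow> y \<in> U \<Longrightarrow> \<rho> x y \<le> ennreal r \<Longrightarrow> (x, y) \<in> scale_rel \<rho> r U"
  unfolding scale_rel_def by auto

text \<open>A finite infimum of natural numbers is attained; an empty index set would give
  \<infinity>.\<close>

lemma asi_le_asi:
  assumes "asi M \<rho> = enat s"
  shows "asi_le M \<rho> s"
proof -
  let ?A = "enat ` {d. asi_le M \<rho> d}"
  have "?A \<noteq> {}"
  proof
    assume empty: "?A = {}"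
    have "asi M \<rho> = \<infinity>" unfolding asi_def empty by (simp add: Inf_enat_def)
    then show False using assms by simp
  qed
  then have "Inf ?A \<in> ?A" unfolding Inf_enat_def by (auto intro: LeastI)
  then show ?thesis using assms unfolding asi_def by auto
qed

section \<open>Thickenings of the covering sets and the combined coloring\<close>

context polish_graph
begin

lemma finite_relpow_Image:
  assumes "finite A"
  shows "finite ((\<Gamma> ^^ n) `` A)"
proof (induction n)
  case (Suc n)
  have "(\<Gamma> ^^ Suc n) `` A = (\<Union>x\<in>(\<Gamma> ^^ n) `` A. {y. (x, y) \<in> \<Gamma>})" by auto
  then show ?case using Suc finite_neighbours by simp
qed (use assms in simp)

text \<open>Such a set lies in a ball of finite radius around one of its points, and balls are
  finite by local finiteness.\<close>

lemma finite_of_ext_diameter: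
  assumes "ext_diameter (graph_metric \<Gamma>) C < \<infinity>"
  shows "finite C"
proof (cases "C = {}")
  case False
  then obtain u where u: "u \<in> C" by blast
  obtain n :: nat where n: "ext_diameter (graph_metric \<Gamma>) C < of_nat n"
    using assms ennreal_Ex_less_of_nat by auto
  have "C \<subseteq> (\<Union>m<n. (\<Gamma> ^^ m) `` {u})"
  proof
    fix v assume v: "v \<in> C"
    have "graph_metric \<Gamma> u v \<le> ext_diameter (graph_metric \<Gamma>) C"
      unfolding ext_diameter_def using u v by (intro SUP_upper2[of u] SUP_upper2[of v]) auto
    then have "graph_metric \<Gamma> u v < of_nat n" using n by (rule order_le_less_trans)
    then show "v \<in> (\<Union>m<n. (\<Gamma> ^^ m) `` {u})" using graph_metric_less_relpow by fastforce
  qed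
  then show ?thesis by (rule finite_subset) (simp add: finite_relpow_Image)
qed simp

text \<open>A walk in \<open>V\<close> is shadowed by points of \<open>U\<close> at distance at most
  1. Consecutive shadows are at distance at most 1 + 1 + 1 = 3, so they all stay in one class
  \<open>C\<close> of the scale relation, and the component lies in \<open>C\<close> together with
  its neighbours.\<close>

lemma finite_components_thickening:
  fixes U :: "'a set"
  defines "V \<equiv> U \<union> \<Gamma> `` U"
  assumes U: "\<And>C. C \<in> U // scale_rel (graph_metric \<Gamma>) 3 U \<Longrightarrow> ext_diameter (graph_metric \<Gamma>) C < \<infinity>"
    and x: "x \<in> V"
  shows "finite ((\<Gamma> \<inter> V \<times> V)\<^sup>* `` {x})"
proof -
  let ?R = "scale_rel (graph_metric \<Gamma>) 3 U"
  have near: "\<exists>u\<in>U. y = u \<or> (u, y) \<in> \<Gamma>" if "y \<in> V" for y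
    using that by (auto simp: V_def)
  obtain u where u: "u \<in> U" "x = u \<or> (u, x) \<in> \<Gamma>" using near[OF x] by blast
  define C where "C = ?R `` {u}"
  have "C \<in> U // ?R" unfolding C_def by (rule quotientI) (rule u)
  then have finC: "finite C" using U finite_of_ext_diameter by blast
  have "\<exists>v\<in>C. y = v \<or> (v, y) \<in> \<Gamma>" if "(x, y) \<in> (\<Gamma> \<inter> V \<times> V)\<^sup>*" for y
    using that
  proof induction
    case base
    have "u \<in> C" unfolding C_def using equiv_class_self[OF equiv_scale_rel u(1)] .
    then show ?case using u by blast
  next
    case (step y z)
    then obtain v where v: "v \<in> C" "y = v \<or> (v, y) \<in> \<Gamma>" by blast
    then have vU: "(u, v) \<in> ?R" "v \<in> U"
      using equiv_type[OF equiv_scale_rel[of U]] by (auto simp: C_def)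
    obtain w where w: "w \<in> U" "z = w \<or> (w, z) \<in> \<Gamma>" using near step.hyps by blast
    have yz: "(y, z) \<in> \<Gamma> ^^ 1" using step.hyps by simp
    have vy: "(v, y) \<in> \<Gamma> ^^ (if y = v then 0 else 1)" using v(2) by auto
    have zw: "(z, w) \<in> \<Gamma> ^^ (if z = w then 0 else 1)" using w(2) symD[OF sym] by auto
    have "(v, w) \<in> (\<Gamma> ^^ (if y = v then 0 else 1) O \<Gamma> ^^ 1) O \<Gamma> ^^ (if z = w then 0 else 1)"
      by (rule relcompI[OF relcompI[OF vy yz] zw])
    then have "(v, w) \<in> \<Gamma> ^^ ((if y = v then 0 else 1) + 1 + (if z = w then 0 else 1))"
      by (simp only: relpow_add)
    then have "graph_metric \<Gamma> v w \<le> of_nat ((if y = v then 0 else 1) + 1 + (if z = w then 0 else 1))"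
      by (rule graph_metric_le_relpow)
    also have "\<dots> \<le> of_nat 3" by (intro of_nat_mono) auto
    also have "\<dots> = ennreal 3" by simp
    finally have "(v, w) \<in> ?R" using vU w by (intro scale_rel_I)
    then have "w \<in> C" using vU equiv_scale_rel[of U] unfolding C_def equiv_def by (blast dest: transD)
    then show ?case using w(2) by blast
  qed
  then have "(\<Gamma> \<inter> V \<times> V)\<^sup>* `` {x} \<subseteq> C \<union> \<Gamma> `` C" by auto
  moreover have "finite (\<Gamma> `` C)" using finite_relpow_Image[OF finC, of 1] by simp
  ultimately show ?thesis using finC by (meson finite_Un finite_subset)
qed

lemma Borel_coloring_asi:
  assumes asi: "asi_le M (graph_metric \<Gamma>) s"
    and c: "\<And>x. x \<in> X \<Longrightarrow> c x < k" "\<And>x y. (x, y) \<in> \<Gamma> \<Longrightarrow> c x \<noteq> (c y :: nat)"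
  obtains g where "g \<in> M \<rightarrow>\<^sub>M count_space (UNIV :: nat set)"
    "\<And>x. x \<in> X \<Longrightarrow> g x < (s + 1) * (k - 1) + 1" "\<And>x y. (x, y) \<in> \<Gamma> \<Longrightarrow> g x \<noteq> g y"
proof -
  obtain U where U: "\<And>i. i \<le> s \<Longrightarrow> U i \<in> sets M" "(\<Union>i\<le>s. U i) = X"
      "\<And>i C. i \<le> s \<Longrightarrow> C \<in> U i // scale_rel (graph_metric \<Gamma>) 3 (U i) \<Longrightarrow> ext_diameter (graph_metric \<Gamma>) C < \<infinity>"
    using asi[unfolded asi_le_def, rule_format, of 3] by (auto simp: space_M)
  \<comment> \<open>The empty sets beyond \<open>s\<close> make this a sequence indexed by all of
    \<open>nat\<close> while the least index chosen below stays at most \<open>s\<close>.\<close>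
  define V where "V i = (if i \<le> s then U i \<union> \<Gamma> `` U i else {})" for i
  have V [measurable]: "V i \<in> sets M" for i using U(1) by (auto simp: V_def)
  have finV: "finite ((\<Gamma> \<inter> V i \<times> V i)\<^sup>* `` {x})" if "x \<in> V i" for i x
    using finite_components_thickening[of "U i" x] U(3)[of i] that by (simp add: V_def split: if_splits)
  have "\<exists>f. f \<in> M \<rightarrow>\<^sub>M count_space (UNIV :: nat set) \<and> (\<forall>x\<in>V i. f x < k) \<and>
      (\<forall>x\<in>V i. \<forall>y\<in>V i. (x, y) \<in> \<Gamma> \<longrightarrow> f x \<noteq> f y)" for i
    by (rule Borel_coloring_finite_components[OF V[of i] finV c]) blast+
  then obtain f where fm [measurable]: "\<And>i. f i \<in> M \<rightarrow>\<^sub>M count_space (UNIV :: nat set)"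
    and f: "\<And>i x. x \<in> V i \<Longrightarrow> f i x < k"
      "\<And>i x y. x \<in> V i \<Longrightarrow> y \<in> V i \<Longrightarrow> (x, y) \<in> \<Gamma> \<Longrightarrow> f i x \<noteq> f i y"
    by metis
  define P where "P x i \<longleftrightarrow> x \<in> V i \<and> 0 < f i x" for x i
  define n where "n x = (LEAST i. P x i)" for x
  \<comment> \<open>Color 0 is the extra one. A pair (i, j) with 0 < j < k becomes 1 + i (k - 1) +
    (j - 1), so that division by \<open>k - 1\<close> recovers it; the existence of such a j makes
    \<open>k - 1\<close> positive.\<close>
  define g where "g x = (if \<exists>i. P x i then 1 + n x * (k - 1) + (f (n x) x - 1) else 0)" for x
  have P: "P x (n x)" if "\<exists>i. P x i" for x
    unfolding n_def using that by (rule LeastI_ex)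
  have Ps: "i \<le> s \<and> x \<in> V i \<and> 0 < f i x \<and> f i x < k" if "P x i" for x i
    using that f(1) by (auto simp: P_def V_def split: if_splits)
  have ediv: "(g x - 1) div (k - 1) = n x" "(g x - 1) mod (k - 1) = f (n x) x - 1" if "\<exists>i. P x i" for x
  proof -
    have "f (n x) x - 1 < k - 1" using Ps[OF P[OF that]] by linarith
    then show "(g x - 1) div (k - 1) = n x" "(g x - 1) mod (k - 1) = f (n x) x - 1"
      using that by (simp_all add: g_def)
  qed
  show ?thesis
  proof
    have [measurable]: "Measurable.pred M (\<lambda>x. P x i)" for i unfolding P_def by measurable
    have [measurable]: "n \<in> M \<rightarrow>\<^sub>M count_space UNIV" unfolding n_def by measurable
    have [measurable]: "(\<lambda>x. f (n x) x) \<in> M \<rightarrow>\<^sub>M count_space UNIV"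
      by (rule measurable_compose_countable[of f]) measurable
    show "g \<in> M \<rightarrow>\<^sub>M count_space UNIV" unfolding g_def by measurable
    show "g x < (s + 1) * (k - 1) + 1" if "x \<in> X" for x
    proof (cases "\<exists>i. P x i")
      case True
      note p = Ps[OF P[OF True]]
      have "n x * (k - 1) \<le> s * (k - 1)" using p by simp
      moreover have "f (n x) x - 1 < k - 1" using p by linarith
      moreover have "g x = 1 + n x * (k - 1) + (f (n x) x - 1)" using True by (simp add: g_def)
      moreover have "(s + 1) * (k - 1) + 1 = s * (k - 1) + (k - 1) + 1" by (simp only: distrib_right mult_1)
      ultimately show ?thesis by linarith
    qed (simp add: g_def)
    show "g x \<noteq> g y" if xy: "(x, y) \<in> \<Gamma>" for x y
    proof
      assume eq: "g x = g y"
      show False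
      proof (cases "\<exists>i. P x i")
        case True
        then have "g x \<noteq> 0" by (simp add: g_def)
        then have True': "\<exists>i. P y i" using eq by (auto simp: g_def split: if_splits)
        have nxy: "n y = n x" using ediv(1)[OF True] ediv(1)[OF True'] eq by simp
        have "f (n x) x - 1 = f (n x) y - 1" using ediv(2)[OF True] ediv(2)[OF True'] eq nxy by simp
        moreover have px: "x \<in> V (n x)" "0 < f (n x) x" using Ps[OF P[OF True]] by simp_all
        moreover have py: "y \<in> V (n x)" "0 < f (n x) y" using Ps[OF P[OF True']] nxy by simp_all
        ultimately have "f (n x) x = f (n x) y" by linarith
        then show False using f(2)[OF px(1) py(1) xy] by simp
      next
        case False
        then have "\<nexists>i. P y i" using eq by (auto simp: g_def split: if_splits)
        \<comment> \<open>This is why the sets are thickened: an edge that starts in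
          \<open>U i\<close> has both ends in \<open>V i\<close>. If both ends are left over, then
          \<open>f i\<close> vanishes at both, although it is proper there.\<close>
        moreover obtain i where "i \<le> s" "x \<in> U i" using U(2) edge_in[OF xy] by blast
        then have V: "x \<in> V i" "y \<in> V i" using xy by (auto simp: V_def)
        ultimately have "f i x = 0" "f i y = 0" using False by (simp_all add: P_def)
        then show False using f(2)[OF V xy] by simp
      qed
    qed
  qed
qed

end

section \<open>Countable color spaces and the final estimate\<close>

lemma standard_Borel_count_space:
  assumes "countable A"
  shows "standard_Borel (count_space A)"
  unfolding standard_Borel_def Polish_space_def
proof (intro exI[of _ "discrete_topology A"] conjI)
  show "separable_space (discrete_topology A)"
    using assms by (simp add: separable_space_discrete_topology)
  have "sigma_sets A (Pow A) = Pow A"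
    using sigma_algebra.sigma_sets_eq[OF sigma_algebra_Pow] .
  moreover have "{U. openin (discrete_topology A) U} = Pow A" by auto
  ultimately show "sets (count_space A) = sigma_sets (space (count_space A)) {U. openin (discrete_topology A) U}"
    by simp
qed (auto simp: completely_metrizable_space_discrete_topology)

lemma Borel_chromatic_number_le_count_space:
  assumes "standard_Borel M" "irrefl \<Gamma>" "countable A"
    and "c \<in> M \<rightarrow>\<^sub>M count_space UNIV" "c \<in> space M \<rightarrow> A"
    and "\<And>x y. x \<in> space M \<Longrightarrow> y \<in> space M \<Longrightarrow> (x, y) \<in> \<Gamma> \<Longrightarrow> c x \<noteq> c y"
  shows "Borel_chromatic_number M \<Gamma> \<le>o |A|"
proof -
  have cA: "c x \<in> A" if "x \<in> space M" for x using assms(5) that by auto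
  have "c \<in> M \<rightarrow>\<^sub>M count_space A"
    using assms(4) cA by (auto simp: measurable_def)
  moreover have "proper_coloring (space M) \<Gamma> A c"
    using assms(5,6) by (auto simp: proper_coloring_def)
  ultimately show ?thesis
    using Borel_chromatic_number_le[OF assms(1,2) standard_Borel_count_space[OF assms(3)], of c]
    by simp
qed

lemma standard_Borel_polish:
  assumes M: "standard_Borel M" and ne: "space M \<noteq> {}"
  obtains d q where "polish_borel (space M) d M q"
proof -
  obtain T where T: "separable_space T" "completely_metrizable_space T" "topspace T = space M"
      "sets M = sigma_sets (space M) {U. openin T U}"
    using M unfolding standard_Borel_def Polish_space_def by blast
  obtain X d where X: "Metric_space X d" "Metric_space.mcomplete X d" "T = Metric_space.mtopology X d"
    using T(2) unfolding completely_metrizable_space_def by blast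
  interpret Metric_space X d by (rule X)
  have XM: "X = space M" using X(3) T(3) by simp
  obtain C where C: "countable C" "C \<subseteq> X" "mtopology closure_of C = X"
    using T(1) X(3) unfolding separable_space_def by auto
  have ex: "\<exists>y\<in>C. d y x < e" if xe: "x \<in> X" "e > 0" for x e
  proof -
    have "x \<in> mtopology closure_of C" using C(3) xe by simp
    then obtain y where "y \<in> C" "y \<in> mball x e" unfolding metric_closure_of using xe by blast
    then show ?thesis by (auto simp: commute)
  qed
  have Cne: "C \<noteq> {}" using ex[of _ 1] ne XM by auto
  have "polish_borel X d M (from_nat_into C)"
  proof
    show "from_nat_into C n \<in> X" for n using from_nat_into[OF Cne] C(2) by blast
    show "\<exists>n. d (from_nat_into C n) x < e" if "x \<in> X" "e > 0" for x e
      using ex[OF that] from_nat_into_surj[OF C(1)] by metis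
  qed (use X(2,3) T(4) XM in auto)
  then show ?thesis using that XM by blast
qed

theorem theorem8p1:
  fixes M :: "'a measure" and \<Gamma> :: "('a \<times> 'a) set" and s :: nat
  assumes "standard_Borel M"
    and "Borel_graph M \<Gamma>"
    and "locally_finite_graph (space M) \<Gamma>"
    and "asi M (graph_metric \<Gamma>) = enat s"
  shows "(finite (Field (chromatic_number (space M) \<Gamma>)) \<longrightarrow>
            finite (Field (Borel_chromatic_number M \<Gamma>)) \<and>
            int (card (Field (Borel_chromatic_number M \<Gamma>)))
              \<le> (int s + 1) * (int (card (Field (chromatic_number (space M) \<Gamma>))) - 1) + 1) \<and>
         (infinite (Field (chromatic_number (space M) \<Gamma>)) \<longrightarrow>
            Borel_chromatic_number M \<Gamma> \<le>o chromatic_number (space M) \<Gamma>)"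
proof -
  let ?X = "space M"
  have irr: "irrefl \<Gamma>" using assms(2) by (simp add: Borel_graph_def)
  have "proper_coloring ?X \<Gamma> ?X id"
    using irr by (auto simp: proper_coloring_def irrefl_def)
  then obtain Z c where Z: "proper_coloring ?X \<Gamma> Z c" "chromatic_number ?X \<Gamma> = |Z|"
    unfolding chromatic_number_def
    using least_card_works(1)[of "\<lambda>Z. \<exists>c. proper_coloring ?X \<Gamma> Z c" ?X] by blast
  \<comment> \<open>This turns a comparison of cardinal orders into one of natural numbers; the
    identity coloring ensures that the least color set exists.\<close>
  have card_le: "finite (Field (Borel_chromatic_number M \<Gamma>)) \<and> card (Field (Borel_chromatic_number M \<Gamma>)) \<le> m"
    if le: "Borel_chromatic_number M \<Gamma> \<le>o |{..<m}|" for m :: nat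
  proof -
    have "\<exists>N c'. standard_Borel N \<and> space N = ?X \<and> c' \<in> M \<rightarrow>\<^sub>M N \<and> proper_coloring ?X \<Gamma> ?X c'"
      using assms(1) \<open>proper_coloring ?X \<Gamma> ?X id\<close> measurable_ident[of M] by blast
    from least_card_works(1)[of "\<lambda>Z. \<exists>N c'. standard_Borel N \<and> space N = Z \<and> c' \<in> M \<rightarrow>\<^sub>M N \<and>
        proper_coloring ?X \<Gamma> Z c'", OF this]
    obtain B where B: "Borel_chromatic_number M \<Gamma> = |B|"
      unfolding Borel_chromatic_number_def by blast
    have "|B| \<le>o |{..<m}|" using le B by simp
    then obtain h where h: "inj_on h B" "h ` B \<subseteq> {..<m}"
      using card_of_ordLeq by metis
    have "finite B" using h inj_on_finite by blast
    moreover have "card B \<le> m" using card_inj_on_le[OF h] by simp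
    ultimately show ?thesis using B by (simp add: Field_card_of)
  qed
  show ?thesis
  proof (cases "?X = {}")
    \<comment> \<open>Both chromatic numbers are 0 here and the integer bound reads (s + 1)(-1) + 1
      = -s, so it must be checked that the separation index of the empty space is 0.\<close>
    case True
    have "proper_coloring ?X \<Gamma> ({} :: 'a set) c" using True by (simp add: proper_coloring_def)
    then have "|Z| \<le>o |{} :: 'a set|" using chromatic_number_le Z(2) by metis
    then have Z0: "Z = {}" using card_of_empty3 by blast
    have "Borel_chromatic_number M \<Gamma> \<le>o |{..<0::nat}|"
    proof (rule Borel_chromatic_number_le_count_space[OF assms(1) irr])
      show "(\<lambda>_. 0) \<in> M \<rightarrow>\<^sub>M count_space UNIV"
        by (simp add: measurable_def True)
    qed (use True assms in auto)
    note 1 = card_le[OF this]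
    have "asi_le M (graph_metric \<Gamma>) 0"
      unfolding asi_le_def using True sets.empty_sets[of M]
      by (intro allI impI exI[of _ "\<lambda>_. {}"]) (auto simp: quotient_def)
    then have "asi M (graph_metric \<Gamma>) \<le> enat 0" unfolding asi_def by (intro INF_lower) simp
    then have "s = 0" unfolding assms(4) enat_ord_simps by simp
    then show ?thesis using 1 Z0 Z(2) by (simp add: Field_card_of)
  next
    case False
    obtain d q where dq: "polish_borel ?X d M q"
      by (rule standard_Borel_polish[OF assms(1) False])
    interpret polish_borel ?X d M q by (rule dq)
    interpret polish_graph ?X d M q \<Gamma>
      by unfold_locales (use assms(2,3) in \<open>simp_all add: Borel_graph_def locally_finite_graph_def\<close>)
    show ?thesis
    proof (intro conjI impI)
      assume "finite (Field (chromatic_number ?X \<Gamma>))"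
      then have fin: "finite Z" using Z(2) by (simp add: Field_card_of)
      have ne: "Z \<noteq> {}" using Z(1) False by (auto simp: proper_coloring_def)
      obtain h :: "'a \<Rightarrow> nat" where h: "bij_betw h Z {..<card Z}"
        using ex_bij_betw_finite_nat[OF fin] by (auto simp: atLeast0LessThan)
      have cZ: "c x \<in> Z" if "x \<in> ?X" for x using Z(1) that by (auto simp: proper_coloring_def)
      have hc1: "(h \<circ> c) x < card Z" if "x \<in> ?X" for x
        using bij_betwE[OF h] cZ[OF that] by auto
      have hc2: "(h \<circ> c) x \<noteq> (h \<circ> c) y" if "(x, y) \<in> \<Gamma>" for x y
      proof -
        have "c x \<in> Z" "c y \<in> Z" "c x \<noteq> c y"
          using edge_in[OF that] cZ Z(1) that by (auto simp: proper_coloring_def)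
        then show ?thesis using bij_betw_imp_inj_on[OF h] by (simp add: inj_on_eq_iff)
      qed
      obtain g where g: "g \<in> M \<rightarrow>\<^sub>M count_space (UNIV :: nat set)"
          "\<And>x. x \<in> ?X \<Longrightarrow> g x < (s + 1) * (card Z - 1) + 1" "\<And>x y. (x, y) \<in> \<Gamma> \<Longrightarrow> g x \<noteq> g y"
        by (rule Borel_coloring_asi[of s "h \<circ> c" "card Z", OF asi_le_asi[OF assms(4)] hc1 hc2])
          (assumption | rule that)+
      have "g \<in> ?X \<rightarrow> {..<(s + 1) * (card Z - 1) + 1}" using g(2) by blast
      from Borel_chromatic_number_le_count_space[OF assms(1) irr _ g(1) this g(3)]
      have "Borel_chromatic_number M \<Gamma> \<le>o |{..<(s + 1) * (card Z - 1) + 1}|" by simp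
      note 1 = card_le[OF this]
      then show "finite (Field (Borel_chromatic_number M \<Gamma>))" by blast
      have "int (card (Field (Borel_chromatic_number M \<Gamma>))) \<le> int ((s + 1) * (card Z - 1) + 1)"
        using 1 by (intro of_nat_mono) blast
      \<comment> \<open>Since \<open>Z\<close> is nonempty, the truncated difference
        \<open>card Z - 1\<close> agrees with the integer one.\<close>
      also have "\<dots> = (int s + 1) * (int (card Z) - 1) + 1"
      proof -
        obtain m where "card Z = Suc m" using fin ne by (metis card_0_eq not0_implies_Suc)
        then show ?thesis by (simp add: algebra_simps)
      qed
      finally show "int (card (Field (Borel_chromatic_number M \<Gamma>)))
          \<le> (int s + 1) * (int (card (Field (chromatic_number ?X \<Gamma>))) - 1) + 1"
        using Z(2) by (simp add: Field_card_of)
    next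
      assume "infinite (Field (chromatic_number ?X \<Gamma>))"
      then have inf: "infinite Z" using Z(2) by (simp add: Field_card_of)
      obtain g where g: "g \<in> M \<rightarrow>\<^sub>M count_space (UNIV :: nat set)" "\<And>x y. (x, y) \<in> \<Gamma> \<Longrightarrow> g x \<noteq> g y"
        by (rule countable_Borel_coloring) (rule that)
      have "Borel_chromatic_number M \<Gamma> \<le>o |UNIV :: nat set|"
        by (rule Borel_chromatic_number_le_count_space[OF assms(1) irr _ g(1) _ g(2)]) simp_all
      also have "|UNIV :: nat set| \<le>o |Z|"
        using inf infinite_iff_card_of_nat[of Z] by simp
      finally show "Borel_chromatic_number M \<Gamma> \<le>o chromatic_number ?X \<Gamma>" using Z(2) by simp
    qed
  qed
qed

end
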